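(* Let $\Gamma\subset SO(3)$ be a finite subgroup, acting on $S^2$ by rotations. Then there exists a $\Gamma$-equivariant $1$-skeleton $\mathcal A^1\subset S^2$ such that $\mathcal A^1$ is a split $\Gamma$-space over its orbit space $A=\mathcal A^1/\Gamma$.
   Context: A $\Gamma$-equivariant $1$-skeleton $\mathcal A^1\subset S^2$ is the $1$-skeleton of a $\Gamma$-equivariant CW decomposition of $S^2$; in particular it is a graph in $S^2$ invariant under $\Gamma$. A split $\Gamma$-space over a topological space $A$ is a triple $(X,\pi,\varphi)$ where $X$ is a $\Gamma$-space (a topological space with a continuous left $\Gamma$-action), $\pi:X\to A$ is a continuous surjective map such that for each $a\in A$ the preimage $\pi^{-1}(a)$ is a single $\Gamma$-orbit, and $\varphi:A\to X$ is a continuous section of $\pi$. Here $X=\mathcal A^1$ and $\pi$ is the quotient map $\mathcal A^1\to\mathcal A^1/\Gamma$. *)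

theory Defs
  imports "HOL-Analysis.Analysis" "HOL-Algebra.Group_Action"
begin

section \<open>Rotation groups\<close>

definition special_orthogonal_group :: "(real^'n^'n) monoid"
  where "special_orthogonal_group =
    \<lparr>carrier = {A. rotation_matrix A}, mult = (**), one = mat 1\<rparr>"

lemma group_special_orthogonal_group: "group special_orthogonal_group"
proof (rule groupI)
  fix A :: "real^'n^'n"
  assume "A \<in> carrier special_orthogonal_group"
  then have A: "orthogonal_matrix A" "det A = 1"
    by (auto simp: special_orthogonal_group_def rotation_matrix_def)
  have "rotation_matrix (transpose A)"
    using A by (simp add: rotation_matrix_def det_transpose)
  moreover have "transpose A ** A = mat 1"
    using A by (simp add: orthogonal_matrix_def)
  ultimately show "\<exists>B\<in>carrier special_orthogonal_group.
      B \<otimes>\<^bsub>special_orthogonal_group\<^esub> A = \<one>\<^bsub>special_orthogonal_group\<^esub>"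
    by (auto simp: special_orthogonal_group_def)
qed (auto simp: special_orthogonal_group_def rotation_matrix_def orthogonal_matrix_mul
       orthogonal_matrix_id det_mul det_I matrix_mul_assoc)

text \<open>Cut off outside \<open>S\<close> because \<^locale>\<open>group_action\<close> asks for extensional functions.\<close>

definition rot_action :: "(real^'n) set \<Rightarrow> real^'n^'n \<Rightarrow> real^'n \<Rightarrow> real^'n"
  where "rot_action S A = (\<lambda>x\<in>S. A *v x)"


section \<open>Spaces with an action of a discrete group\<close>

definition gamma_space ::
    "('g, 'm) monoid_scheme \<Rightarrow> 'a topology \<Rightarrow> ('g \<Rightarrow> 'a \<Rightarrow> 'a) \<Rightarrow> bool"
  where "gamma_space G X act \<longleftrightarrow>
    group_action G (topspace X) act \<and>
    continuous_map (prod_topology (discrete_topology (carrier G)) X) X (\<lambda>(g, x). act g x)"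

definition orbit_space ::
    "('g, 'm) monoid_scheme \<Rightarrow> 'a topology \<Rightarrow> ('g \<Rightarrow> 'a \<Rightarrow> 'a) \<Rightarrow> 'a set topology"
  where "orbit_space G X act =
    topology (\<lambda>U. U \<subseteq> orbits G (topspace X) act \<and>
                  openin X {x \<in> topspace X. orbit G act x \<in> U})"

lemma openin_orbit_space:
  "openin (orbit_space G X act) U \<longleftrightarrow>
     U \<subseteq> orbits G (topspace X) act \<and> openin X {x \<in> topspace X. orbit G act x \<in> U}"
proof -
  have "istopology (\<lambda>U. U \<subseteq> orbits G (topspace X) act \<and>
                        openin X {x \<in> topspace X. orbit G act x \<in> U})"
    unfolding istopology_def
  proof (intro conjI allI impI)
    fix S T
    assume "S \<subseteq> orbits G (topspace X) act \<and> openin X {x \<in> topspace X. orbit G act x \<in> S}"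
      and "T \<subseteq> orbits G (topspace X) act \<and> openin X {x \<in> topspace X. orbit G act x \<in> T}"
    then have "openin X ({x \<in> topspace X. orbit G act x \<in> S} \<inter>
                         {x \<in> topspace X. orbit G act x \<in> T})"
      by blast
    moreover have "{x \<in> topspace X. orbit G act x \<in> S} \<inter> {x \<in> topspace X. orbit G act x \<in> T}
                   = {x \<in> topspace X. orbit G act x \<in> S \<inter> T}"
      by blast
    ultimately show "openin X {x \<in> topspace X. orbit G act x \<in> S \<inter> T}"
      by simp
  next
    fix \<K>
    assume "\<forall>K\<in>\<K>. K \<subseteq> orbits G (topspace X) act \<and>
                    openin X {x \<in> topspace X. orbit G act x \<in> K}"
    then have "openin X (\<Union>K\<in>\<K>. {x \<in> topspace X. orbit G act x \<in> K})"
      by blast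
    moreover have "(\<Union>K\<in>\<K>. {x \<in> topspace X. orbit G act x \<in> K})
                   = {x \<in> topspace X. orbit G act x \<in> \<Union>\<K>}"
      by blast
    ultimately show "openin X {x \<in> topspace X. orbit G act x \<in> \<Union>\<K>}"
      by simp
  qed blast+
  then show ?thesis
    by (simp add: orbit_space_def topology_inverse')
qed

lemma topspace_orbit_space: "topspace (orbit_space G X act) = orbits G (topspace X) act"
proof -
  have "{x \<in> topspace X. orbit G act x \<in> orbits G (topspace X) act} = topspace X"
    by (auto simp: orbits_def)
  then have "openin (orbit_space G X act) (orbits G (topspace X) act)"
    by (simp add: openin_orbit_space)
  then show ?thesis
    by (metis openin_orbit_space openin_subset openin_topspace subset_antisym)
qed

lemma quotient_map_orbit: "quotient_map X (orbit_space G X act) (orbit G act)"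
  by (auto simp: quotient_map_def topspace_orbit_space openin_orbit_space orbits_def)

definition split_gamma_space ::
    "('g, 'm) monoid_scheme \<Rightarrow> 'a topology \<Rightarrow> ('g \<Rightarrow> 'a \<Rightarrow> 'a) \<Rightarrow> 'b topology
      \<Rightarrow> ('a \<Rightarrow> 'b) \<Rightarrow> ('b \<Rightarrow> 'a) \<Rightarrow> bool"
  where "split_gamma_space G X act A \<pi> \<phi> \<longleftrightarrow>
    gamma_space G X act \<and>
    continuous_map X A \<pi> \<and> \<pi> ` topspace X = topspace A \<and>
    (\<forall>a\<in>topspace A. {x \<in> topspace X. \<pi> x = a} \<in> orbits G (topspace X) act) \<and>
    continuous_map A X \<phi> \<and> (\<forall>a\<in>topspace A. \<pi> (\<phi> a) = a)"


section \<open>Equivariant CW decompositions\<close>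

definition closed_disc :: "nat \<Rightarrow> (nat \<Rightarrow> real) topology"
  where "closed_disc n = subtopology (Euclidean_space n) {x. (\<Sum>i<n. (x i)\<^sup>2) \<le> 1}"

definition open_disc :: "nat \<Rightarrow> (nat \<Rightarrow> real) topology"
  where "open_disc n = subtopology (Euclidean_space n) {x. (\<Sum>i<n. (x i)\<^sup>2) < 1}"

text \<open>
  A CW decomposition of \<open>X\<close> is given by the family \<open>E\<close>, where \<open>E n\<close> is the set of its open
  \<open>n\<close>-cells. The map \<open>f\<close> is a characteristic map of the cell \<open>e\<close>; the last two conditions
  are closure finiteness (with the boundary lying in lower-dimensional cells) and the weak
  topology.
\<close>

definition cw_decomposition :: "'a topology \<Rightarrow> (nat \<Rightarrow> 'a set set) \<Rightarrow> bool"
  where "cw_decomposition X E \<longleftrightarrow>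
    Hausdorff_space X \<and>
    (\<Union>n. \<Union>(E n)) = topspace X \<and>
    (\<forall>m n. \<forall>d\<in>E m. \<forall>e\<in>E n. m \<noteq> n \<or> d \<noteq> e \<longrightarrow> d \<inter> e = {}) \<and>
    (\<forall>n. \<forall>e\<in>E n. \<exists>f.
        continuous_map (closed_disc n) X f \<and>
        homeomorphic_map (open_disc n) (subtopology X e) f \<and>
        (\<exists>\<F>. finite \<F> \<and> \<F> \<subseteq> (\<Union>k<n. E k) \<and>
              f ` (topspace (closed_disc n) - topspace (open_disc n)) \<subseteq> \<Union>\<F>)) \<and>
    (\<forall>C\<subseteq>topspace X.
        (\<forall>n. \<forall>e\<in>E n. closedin X (C \<inter> X closure_of e)) \<longrightarrow> closedin X C)"

definition skeleton :: "(nat \<Rightarrow> 'a set set) \<Rightarrow> nat \<Rightarrow> 'a set"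
  where "skeleton E n = (\<Union>k\<le>n. \<Union>(E k))"

text \<open>
  For a discrete group, a decomposition into equivariant cells \<open>G/H \<times> D\<^sup>n\<close> is a CW
  decomposition whose open cells are permuted by \<open>G\<close> in such a way that an element mapping a
  cell to itself fixes it pointwise.
\<close>

definition equivariant_cw_decomposition ::
    "('g, 'm) monoid_scheme \<Rightarrow> 'a topology \<Rightarrow> ('g \<Rightarrow> 'a \<Rightarrow> 'a)
      \<Rightarrow> (nat \<Rightarrow> 'a set set) \<Rightarrow> bool"
  where "equivariant_cw_decomposition G X act E \<longleftrightarrow>
    gamma_space G X act \<and> cw_decomposition X E \<and>
    (\<forall>g\<in>carrier G. \<forall>n. \<forall>e\<in>E n.
        act g ` e \<in> E n \<and> (act g ` e = e \<longrightarrow> (\<forall>x\<in>e. act g x = x)))"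

definition equivariant_one_skeleton ::
    "('g, 'm) monoid_scheme \<Rightarrow> 'a topology \<Rightarrow> ('g \<Rightarrow> 'a \<Rightarrow> 'a) \<Rightarrow> 'a set \<Rightarrow> bool"
  where "equivariant_one_skeleton G X act S \<longleftrightarrow>
    (\<exists>E. equivariant_cw_decomposition G X act E \<and> S = skeleton E 1)"

end

theory Submission
  imports Defs "HOL-Complex_Analysis.Conformal_Mappings"
begin

text \<open>
  Averaging the stereographic projection from a point with trivial stabiliser over \<open>\<Gamma>\<close> gives
  an invariant map \<open>f\<close> onto the Riemann sphere. It is rational of degree \<open>|\<Gamma>|\<close>, so its fibres are
  exactly the orbits, and the orbit space is a sphere. A homeomorphism of the plane moves the
  finitely many branch values to the negative real axis. The map \<open>u \<mapsto> ((1 + u) / (1 - u))\<^sup>2\<close> folds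
  the closed unit disc onto the Riemann sphere: it is injective inside and glues \<open>u\<close> to its conjugate
  on the circle, which covers the negative real axis. Off finitely many boundary points it lifts
  through the branched covering \<open>f\<close>, and the lift \<open>L\<close> extends continuously to the closed disc. The
  translates under \<open>\<Gamma>\<close> of the image of the open disc are the 2-cells, the translates of the image of
  the circle form the 1-skeleton, and the image of the upper semicircle is a compact set meeting
  every orbit in the 1-skeleton exactly once.
\<close>

text \<open>A section over a graph in the orbit sphere is obstructed by monodromy around the loops
  of the graph. The graph is therefore chosen with an arc as its quotient: an arc has no loops, and
  its complement in the orbit sphere is still an open disc, as the 2-cells require. The arc must run
  through every branch value. Otherwise a singular point would lie inside a 2-cell, and a nontrivial
  rotation fixing that point would map the cell to itself without fixing it pointwise. This is why
  the branch values are collected on the negative axis, the seam of the folding. The price is a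
  homeomorphism that need not be holomorphic, so only topological facts about the orbit map are
  carried past that step.

  The projection starts from a point with trivial stabiliser so that at each point of its orbit
  exactly one summand has a pole. Nothing can cancel there, and the invariant map tends to
  \<infinity> along the whole orbit; this gives the compactness that stands in for the missing value
  \<infinity>.\<close>

no_notation fps_nth (infixl "$" 75)

text \<open>Inverse rotations are written \<open>transpose g *v x\<close> throughout; the deleted
  rule would turn them into \<open>x v* g\<close>.\<close>

declare transpose_matrix_vector [simp del]


section \<open>Finite groups of rotations\<close>

text \<open>Cramer's rule for the basis \<open>x\<close>, \<open>y\<close>,
  \<open>cross3 x y\<close>, multiplied by its determinant, the squared length of
  \<open>cross3 x y\<close>.\<close>

lemma cross3_dual_basis:
  fixes x y w :: "real^3"
  shows "(cross3 x y \<bullet> cross3 x y) *\<^sub>R w =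
    (w \<bullet> cross3 y (cross3 x y)) *\<^sub>R x + (w \<bullet> cross3 (cross3 x y) x) *\<^sub>R y + (w \<bullet> cross3 x y) *\<^sub>R cross3 x y"
  unfolding vec_eq_iff forall_3
  by (simp add: cross3_simps)

text \<open>Rotations preserve cross products, so a third basis vector is fixed as well. Reflection
  in the plane of \<open>x\<close> and \<open>y\<close> shows that the determinant matters.\<close>

lemma rotation_matrix_fixing_two_points:
  fixes A :: "real^3^3"
  assumes A: "rotation_matrix A" and x: "A *v x = x" and y: "A *v y = y"
    and c: "cross3 x y \<noteq> 0"
  shows "A = mat 1"
proof -
  have z: "A *v cross3 x y = cross3 x y"
    using cross_rotation_matrix[OF A, of x y] x y by simp
  have "A *v w = w" for w
  proof -
    have "(cross3 x y \<bullet> cross3 x y) *\<^sub>R (A *v w) = A *v ((cross3 x y \<bullet> cross3 x y) *\<^sub>R w)"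
      by (simp add: matrix_vector_mult_scaleR)
    also have "\<dots> = (cross3 x y \<bullet> cross3 x y) *\<^sub>R w"
      by (simp only: cross3_dual_basis matrix_vector_right_distrib matrix_vector_mult_scaleR x y z)
    finally show ?thesis
      using c by simp
  qed
  then show ?thesis
    by (simp add: matrix_eq)
qed

text \<open>Two fixed unit vectors have vanishing cross product, and Lagrange's identity then makes
  them equal or opposite.\<close>

lemma finite_rotation_fixed_points:
  fixes A :: "real^3^3"
  assumes A: "rotation_matrix A" and ne: "A \<noteq> mat 1"
  shows "finite {x \<in> sphere 0 1. A *v x = x}"
proof (cases "\<exists>a \<in> sphere 0 1. A *v a = a")
  case True
  then obtain a where a: "norm a = 1" "A *v a = a" by auto
  have "x \<in> {a, - a}" if "norm x = 1" "A *v x = x" for x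
  proof -
    have "cross3 a x = 0"
      using rotation_matrix_fixing_two_points[OF A a(2) that(2)] ne by blast
    then have "norm a = 1 \<and> (a \<bullet> x)\<^sup>2 = 1"
      using norm_cross_dot[of a x] a that by simp
    then have "a \<bullet> x = 1 \<or> a \<bullet> x = -1"
      by (simp add: power2_eq_1_iff)
    then show ?thesis
    proof
      assume "a \<bullet> x = 1"
      then have "(norm (x - a))\<^sup>2 = 0"
        using a that by (simp add: dot_norm_neg[symmetric] power2_norm_eq_inner inner_diff inner_commute norm_eq_1)
      then show ?thesis by simp
    next
      assume "a \<bullet> x = -1"
      then have "(norm (x + a))\<^sup>2 = 0"
        using a that by (simp add: power2_norm_eq_inner inner_add inner_commute norm_eq_1)
      then have "x + a = 0" by simp
      then show ?thesis by (simp add: eq_neg_iff_add_eq_0)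
    qed
  qed
  then have "{x \<in> sphere 0 1. A *v x = x} \<subseteq> {a, - a}" by auto
  then show ?thesis by (rule finite_subset) auto
next
  case False
  then have "{x \<in> sphere 0 1. A *v x = x} = {}" by blast
  then show ?thesis by (simp only: finite.emptyI)
qed

lemma continuous_on_matrix_vector [continuous_intros]:
  fixes A :: "real^'n^'m"
  assumes "continuous_on S f"
  shows "continuous_on S (\<lambda>x. A *v f x)"
  by (rule bounded_linear.continuous_on[OF matrix_vector_mul_bounded_linear assms])

locale finite_rotation_group =
  fixes \<Gamma> :: "(real^3^3) set"
  assumes fin: "finite \<Gamma>"
    and rot: "g \<in> \<Gamma> \<Longrightarrow> rotation_matrix g"
    and one: "mat 1 \<in> \<Gamma>"
    and mult: "g \<in> \<Gamma> \<Longrightarrow> h \<in> \<Gamma> \<Longrightarrow> g ** h \<in> \<Gamma>"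
    and inv: "g \<in> \<Gamma> \<Longrightarrow> transpose g \<in> \<Gamma>"
begin

definition orb :: "real^3 \<Rightarrow> (real^3) set"
  where "orb x = (\<lambda>g. g *v x) ` \<Gamma>"

definition singular_points :: "(real^3) set"
  where "singular_points = {x \<in> sphere 0 1. \<exists>g\<in>\<Gamma>. g \<noteq> mat 1 \<and> g *v x = x}"

lemma transpose_mult: "g \<in> \<Gamma> \<Longrightarrow> transpose g ** g = mat 1" "g \<in> \<Gamma> \<Longrightarrow> g ** transpose g = mat 1"
  using rot by (auto simp: rotation_matrix_def orthogonal_matrix_def)

lemma transpose_mult_vec [simp]:
  "g \<in> \<Gamma> \<Longrightarrow> transpose g *v (g *v x) = x" "g \<in> \<Gamma> \<Longrightarrow> g *v (transpose g *v x) = x"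
  by (simp_all add: matrix_vector_mul_assoc transpose_mult)

lemma norm_act [simp]: "g \<in> \<Gamma> \<Longrightarrow> norm (g *v x) = norm x"
  using rot orthogonal_transformation_matrix[of "(*v) g"]
  by (auto simp: rotation_matrix_def intro!: orthogonal_transformation_norm)

lemma act_eq_iff: "g \<in> \<Gamma> \<Longrightarrow> g *v x = g *v y \<longleftrightarrow> x = y"
  by (metis transpose_mult_vec(1))

lemma orb_refl [simp]: "x \<in> orb x"
  using one by (force simp: orb_def)

lemma orbI: "g \<in> \<Gamma> \<Longrightarrow> g *v x \<in> orb x"
  by (auto simp: orb_def)

lemma orb_sym: "y \<in> orb x \<Longrightarrow> x \<in> orb y"
  by (auto simp: orb_def image_iff) (metis inv transpose_mult_vec(1))

lemma orb_trans: "y \<in> orb x \<Longrightarrow> z \<in> orb y \<Longrightarrow> z \<in> orb x"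
  by (auto simp: orb_def image_iff matrix_vector_mul_assoc) (metis mult)

lemma orb_act: "g \<in> \<Gamma> \<Longrightarrow> g *v x \<in> orb y \<longleftrightarrow> x \<in> orb y"
  using orbI orb_sym orb_trans by meson

lemma finite_orb [simp]: "finite (orb x)"
  by (simp add: orb_def fin)

lemma orb_subset_sphere: "x \<in> sphere 0 1 \<Longrightarrow> orb x \<subseteq> sphere 0 1"
  by (auto simp: orb_def)

lemma finite_singular_points: "finite singular_points"
proof -
  have "singular_points = (\<Union>g\<in>\<Gamma> - {mat 1}. {x \<in> sphere 0 1. g *v x = x})"
    by (auto simp: singular_points_def)
  then show ?thesis
    using fin rot finite_rotation_fixed_points by fastforce
qed

text \<open>Stabilisers along an orbit are conjugate, and conjugation keeps them nontrivial.\<close>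

lemma act_singular_points:
  assumes "g \<in> \<Gamma>"
  shows "g *v x \<in> singular_points \<longleftrightarrow> x \<in> singular_points"
proof -
  have *: "h *v y \<in> singular_points" if "h \<in> \<Gamma>" "y \<in> singular_points" for h y
  proof -
    from that(2) obtain k where k: "norm y = 1" "k \<in> \<Gamma>" "k \<noteq> mat 1" "k *v y = y"
      by (auto simp: singular_points_def)
    let ?k = "h ** k ** transpose h"
    have "?k *v (h *v y) = h *v y"
      using that k by (simp flip: matrix_vector_mul_assoc)
    moreover have "?k \<noteq> mat 1"
    proof
      assume "?k = mat 1"
      moreover have "transpose h ** ?k ** h = (transpose h ** h) ** k ** (transpose h ** h)"
        by (simp only: matrix_mul_assoc)
      ultimately show False using k that by (simp add: transpose_mult)
    qed
    ultimately show ?thesis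
      using that k by (auto simp: singular_points_def intro!: bexI[of _ ?k] mult inv)
  qed
  from *[OF assms, of x] *[OF inv[OF assms], of "g *v x"] assms show ?thesis
    by auto
qed

lemma act_inj_regular:
  assumes "x \<in> sphere 0 1" "x \<notin> singular_points" "g \<in> \<Gamma>" "h \<in> \<Gamma>" "g *v x = h *v x"
  shows "g = h"
proof -
  have "(transpose h ** g) *v x = x"
    using assms by (simp flip: matrix_vector_mul_assoc)
  then have "transpose h ** g = mat 1"
    using assms mult inv by (auto simp: singular_points_def)
  then have "h ** (transpose h ** g) = h" by simp
  then show ?thesis
    using assms by (simp add: matrix_mul_assoc transpose_mult)
qed

lemma card_orb_regular:
  assumes "x \<in> sphere 0 1" "x \<notin> singular_points"
  shows "card (orb x) = card \<Gamma>"
  unfolding orb_def by (rule card_image) (use act_inj_regular assms in \<open>auto intro!: inj_onI\<close>)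

text \<open>Disjoint finite orbits have disjoint open neighbourhoods. Shrinking these to the points
  all of whose translates stay inside makes them invariant, and they remain open because
  \<open>\<Gamma>\<close> is finite.\<close>

lemma separating_neighbourhoods:
  assumes "y \<notin> orb x"
  obtains V W where "open V" "open W" "x \<in> V" "y \<in> W" "\<And>v w. v \<in> V \<Longrightarrow> w \<in> W \<Longrightarrow> w \<notin> orb v"
proof -
  have "orb x \<inter> orb y = {}"
    using assms orb_sym orb_trans by blast
  then obtain V W where VW: "open V" "open W" "orb x \<subseteq> V" "orb y \<subseteq> W" "V \<inter> W = {}"
    using separation_normal[of "orb x" "orb y"] finite_imp_closed finite_orb by metis
  have o: "open {v. \<forall>g\<in>\<Gamma>. g *v v \<in> U}" if "open U" for U
  proof -
    have "{v. \<forall>g\<in>\<Gamma>. g *v v \<in> U} = (\<Inter>g\<in>\<Gamma>. (\<lambda>v. g *v v) -` U)" by auto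
    then show ?thesis
      using fin that by (auto intro!: open_INT open_vimage linear_continuous_on matrix_vector_mul_bounded_linear)
  qed
  show ?thesis
  proof
    show "open {v. \<forall>g\<in>\<Gamma>. g *v v \<in> V}" "open {v. \<forall>g\<in>\<Gamma>. g *v v \<in> W}"
      using VW o by auto
    show "x \<in> {v. \<forall>g\<in>\<Gamma>. g *v v \<in> V}" "y \<in> {v. \<forall>g\<in>\<Gamma>. g *v v \<in> W}"
      using VW by (auto simp: orb_def)
    show "w \<notin> orb v" if "v \<in> {v. \<forall>g\<in>\<Gamma>. g *v v \<in> V}" "w \<in> {v. \<forall>g\<in>\<Gamma>. g *v v \<in> W}" for v w
    proof
      assume "w \<in> orb v"
      then have "w \<in> V" using that(1) by (auto simp: orb_def)
      moreover have "w \<in> W" using that(2) one by (metis (mono_tags) matrix_vector_mul_lid mem_Collect_eq)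
      ultimately show False using VW(5) by blast
    qed
  qed
qed

end

lemma infinite_sphere3: "infinite (sphere (0::real^3) 1)"
proof
  assume "finite (sphere (0::real^3) 1)"
  moreover have "connected (sphere (0::real^3) 1)" by (rule connected_sphere) simp
  moreover have "axis 1 1 \<in> sphere (0::real^3) 1" by simp
  ultimately obtain a where a: "sphere (0::real^3) 1 \<subseteq> {a}"
    using connected_finite_iff_sing by (metis empty_iff order_refl)
  have "axis 1 1 \<in> sphere (0::real^3) 1" "- axis 1 1 \<in> sphere (0::real^3) 1" by auto
  with a have "axis 1 1 = - (axis 1 1 :: real^3)" by blast
  then have "(axis 1 1 :: real^3) $ 1 = (- axis 1 1 :: real^3) $ 1" by (rule arg_cong)
  then show False by (simp add: axis_def)
qed

section \<open>The cell structure spanned by a fundamental disc\<close>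

text \<open>A continuous map from a compact to a Hausdorff space is closed, and it stays closed on
  saturated subsets. Injectivity compares points of \<open>U\<close> with points of the whole space,
  since this is what makes \<open>U\<close> saturated.\<close>

lemma homeomorphic_map_onto_image:
  assumes "compact_space X" "Hausdorff_space Y" "continuous_map X Y f" "U \<subseteq> topspace X"
    and inj: "\<And>x y. x \<in> U \<Longrightarrow> y \<in> topspace X \<Longrightarrow> f x = f y \<Longrightarrow> x = y"
  shows "homeomorphic_map (subtopology X U) (subtopology Y (f ` U)) f"
proof (rule bijective_closed_imp_homeomorphic_map)
  have eq: "{x \<in> topspace X. f x \<in> f ` U} = U"
  proof
    show "{x \<in> topspace X. f x \<in> f ` U} \<subseteq> U"
    proof
      fix y assume "y \<in> {x \<in> topspace X. f x \<in> f ` U}"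
      then obtain x where "x \<in> U" "f x = f y" "y \<in> topspace X" by auto
      then show "y \<in> U" using inj[of x y] by simp
    qed
  qed (use assms(4) in auto)
  show "closed_map (subtopology X U) (subtopology Y (f ` U)) f"
    using continuous_imp_closed_map[OF assms(3,1,2)] eq by (rule closed_map_restriction)
  show "continuous_map (subtopology X U) (subtopology Y (f ` U)) f"
    using continuous_map_from_subtopology[OF assms(3)] assms(4)
    by (simp add: continuous_map_in_subtopology Int_absorb1)
  have fU: "f ` U \<subseteq> topspace Y"
    using assms(3,4) by (auto simp: continuous_map_def)
  then show "f ` topspace (subtopology X U) = topspace (subtopology Y (f ` U))"
    using assms(4) by (simp add: Int_absorb1)
  show "inj_on f (topspace (subtopology X U))"
    using inj assms(4) by (auto simp: inj_on_def)
qed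

section \<open>Discs as compact sets of sequences\<close>

definition disc_points :: "nat \<Rightarrow> (nat \<Rightarrow> real) set"
  where "disc_points n = {x. (\<forall>i\<ge>n. x i = 0) \<and> (\<Sum>i<n. (x i)\<^sup>2) \<le> 1}"

lemma closed_disc_eq: "closed_disc n = top_of_set (disc_points n)"
  unfolding closed_disc_def Euclidean_space_def euclidean_product_topology subtopology_subtopology disc_points_def
  by (rule arg_cong[of _ _ "subtopology euclidean"]) auto

lemma topspace_closed_disc: "topspace (closed_disc n) = disc_points n"
  by (simp add: closed_disc_eq)

lemma open_disc_eq: "open_disc n = subtopology (closed_disc n) {x \<in> disc_points n. (\<Sum>i<n. (x i)\<^sup>2) < 1}"
  unfolding closed_disc_def open_disc_def Euclidean_space_def euclidean_product_topology subtopology_subtopology disc_points_def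
  by (rule arg_cong[of _ _ "subtopology euclidean"]) auto

lemma topspace_open_disc: "topspace (open_disc n) = {x \<in> disc_points n. (\<Sum>i<n. (x i)\<^sup>2) < 1}"
  unfolding open_disc_eq by (auto simp: topspace_closed_disc)

text \<open>The ambient space consists of infinite sequences, so compactness comes from Tychonoff's
  theorem: the disc is closed in a product of intervals.\<close>

lemma compact_disc_points: "compact (disc_points n)"
proof -
  have "compactin (product_topology (\<lambda>i::nat. euclideanreal) UNIV) (PiE UNIV (\<lambda>i. {-1..1}))"
    by (simp add: compactin_PiE)
  then have c: "compact (PiE UNIV (\<lambda>i::nat. {-1..1::real}))"
    by (simp add: euclidean_product_topology)
  have "disc_points n = PiE UNIV (\<lambda>i. {-1..1}) \<inter> disc_points n"
  proof -
    have "\<bar>x i\<bar> \<le> 1" if "x \<in> disc_points n" for x i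
    proof (cases "i < n")
      case True
      then have "(x i)\<^sup>2 \<le> (\<Sum>i<n. (x i)\<^sup>2)" by (intro member_le_sum) auto
      then have "(x i)\<^sup>2 \<le> 1" using that by (auto simp: disc_points_def)
      then show ?thesis by (simp add: abs_square_le_1)
    next
      case False
      then show ?thesis using that by (auto simp: disc_points_def)
    qed
    then show ?thesis by (auto simp: abs_le_iff minus_le_iff)
  qed
  moreover have "closed (disc_points n)"
  proof -
    have "disc_points n = (\<Inter>i\<in>{n..}. {x. x i = 0}) \<inter> {x. (\<Sum>i<n. (x i)\<^sup>2) \<le> 1}"
      by (auto simp: disc_points_def)
    moreover have "closed {x::nat \<Rightarrow> real. x i = 0}" for i
      by (intro closed_Collect_eq continuous_on_product_coordinates continuous_on_const)
    moreover have "closed {x::nat \<Rightarrow> real. (\<Sum>i<n. (x i)\<^sup>2) \<le> 1}"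
      by (intro closed_Collect_le continuous_on_sum continuous_on_power continuous_on_product_coordinates continuous_on_const)
    ultimately show ?thesis by (simp only:) (intro closed_Int closed_INT ballI)
  qed
  ultimately show ?thesis using compact_Int_closed[OF c] by metis
qed

lemma compact_space_closed_disc: "compact_space (closed_disc n)"
  by (simp add: closed_disc_eq compact_space_subtopology compact_disc_points)

section \<open>The boundary arc and a strict fundamental domain\<close>

definition upper_arc :: "real \<Rightarrow> complex"
  where "upper_arc t = cis (pi * t)"

lemma cmod_arc [simp]: "cmod (upper_arc t) = 1"
  by (simp add: upper_arc_def)

lemma continuous_on_arc [continuous_intros]: "continuous_on A f \<Longrightarrow> continuous_on A (\<lambda>x. upper_arc (f x))"
  unfolding upper_arc_def by (intro continuous_intros)

lemma Im_arc: "t \<in> {0..1} \<Longrightarrow> Im (upper_arc t) \<ge> 0"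
  by (auto simp: upper_arc_def intro!: sin_ge_zero mult_left_le)

lemma upper_arc_inj: "s \<in> {0..1} \<Longrightarrow> t \<in> {0..1} \<Longrightarrow> upper_arc s = upper_arc t \<longleftrightarrow> s = t"
proof -
  assume st: "s \<in> {0..1}" "t \<in> {0..1}"
  have "s = t" if "upper_arc s = upper_arc t"
  proof -
    have "cos (pi * s) = cos (pi * t)" using that by (metis upper_arc_def cis.sel(1))
    then have "pi * s = pi * t"
      using st by (intro cos_inj_pi[of "pi * s" "pi * t"]) (auto intro: mult_left_le)
    then show ?thesis by simp
  qed
  then show ?thesis by auto
qed

lemma upper_arc_surj:
  assumes "cmod u = 1" "Im u \<ge> 0"
  shows "\<exists>t\<in>{0..1}. u = upper_arc t"
proof
  have R: "\<bar>Re u\<bar> \<le> 1" using abs_Re_le_cmod[of u] assms by simp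
  show "u = upper_arc (arccos (Re u) / pi)"
  proof (rule complex_eqI)
    have "(Re u)\<^sup>2 + (Im u)\<^sup>2 = 1" using assms by (metis cmod_power2 one_power2)
    then have "(Im u)\<^sup>2 = 1 - (Re u)\<^sup>2" by linarith
    then have "Im u = sqrt (1 - (Re u)\<^sup>2)" using assms by (metis real_sqrt_unique)
    then show "Im u = Im (upper_arc (arccos (Re u) / pi))"
      using R by (simp add: upper_arc_def sin_arccos_abs)
    show "Re u = Re (upper_arc (arccos (Re u) / pi))"
      using R by (simp add: upper_arc_def)
  qed
  show "arccos (Re u) / pi \<in> {0..1}"
    using R arccos_lbound[of "Re u"] arccos_ubound[of "Re u"] by auto
qed

text \<open>Together the conditions say that \<open>L\<close> induces a bijection onto the orbit
  space from the closed disc with \<open>u\<close> and \<open>cnj u\<close> glued on the circle, and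
  that all singular points lie on the seam.\<close>

locale fundamental_disc_map = finite_rotation_group +
  fixes L :: "complex \<Rightarrow> real^3"
  assumes L_cont: "continuous_on (cball 0 1) L"
    and L_sphere: "L ` cball 0 1 \<subseteq> sphere 0 1"
    and L_surj: "x \<in> sphere 0 1 \<Longrightarrow> \<exists>u\<in>cball 0 1. L u \<in> orb x"
    and L_inj: "u \<in> cball 0 1 \<Longrightarrow> v \<in> cball 0 1 \<Longrightarrow> L v \<in> orb (L u) \<Longrightarrow> v = u \<or> cmod u = 1 \<and> v = cnj u"
    and L_cnj: "cmod u = 1 \<Longrightarrow> L (cnj u) \<in> orb (L u)"
    and L_singular: "finite {u \<in> cball 0 1. L u \<in> singular_points}"
      "{u \<in> cball 0 1. L u \<in> singular_points} \<subseteq> sphere 0 1"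
begin

text \<open>The open disc with half of its boundary: of two conjugate boundary points only the upper
  one is kept, so that each orbit is met exactly once.\<close>

definition half_disc :: "complex set"
  where "half_disc = ball 0 1 \<union> upper_arc ` {0..1}"

lemma half_disc_iff: "u \<in> half_disc \<longleftrightarrow> cmod u \<le> 1 \<and> (cmod u = 1 \<longrightarrow> Im u \<ge> 0)"
proof -
  have "u \<in> upper_arc ` {0..1} \<longleftrightarrow> cmod u = 1 \<and> Im u \<ge> 0"
    using upper_arc_surj[of u] Im_arc by auto
  then show ?thesis by (auto simp: half_disc_def)
qed

lemma half_disc_inj:
  assumes "u \<in> half_disc" "v \<in> half_disc" "g \<in> \<Gamma>" "h \<in> \<Gamma>" "g *v L u = h *v L v"
  shows "u = v"
proof -
  have "L v \<in> orb (L u)"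
    using orb_act[OF assms(4), of "L v" "L u"] orbI[OF assms(3), of "L u"] assms(5) by simp
  then have "v = u \<or> cmod u = 1 \<and> v = cnj u"
    using L_inj[of u v] assms by (simp add: half_disc_iff)
  moreover have "Im u = 0" if "cmod u = 1" "v = cnj u"
    using assms(1,2) that by (simp add: half_disc_iff)
  ultimately show ?thesis
    by (auto simp: complex_eq_iff)
qed

lemma circle_cover:
  assumes "cmod u = 1"
  shows "\<exists>g\<in>\<Gamma>. \<exists>t\<in>{0..1}. L u = g *v L (upper_arc t)"
proof (cases "Im u \<ge> 0")
  case True
  then show ?thesis using upper_arc_surj[OF assms] one by force
next
  case False
  then obtain t where t: "t \<in> {0..1}" "cnj u = upper_arc t"
    using upper_arc_surj[of "cnj u"] assms by auto
  have "L u \<in> orb (L (upper_arc t))" using L_cnj[of "cnj u"] assms unfolding t(2)[symmetric] by simp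
  then obtain g where "g \<in> \<Gamma>" "L u = g *v L (upper_arc t)" by (auto simp: orb_def)
  then show ?thesis using t(1) by blast
qed

lemma half_disc_cover:
  assumes "x \<in> sphere 0 1"
  shows "\<exists>g\<in>\<Gamma>. \<exists>u\<in>half_disc. x = g *v L u"
proof -
  obtain u where u: "u \<in> cball 0 1" "L u \<in> orb x" using L_surj[OF assms] by blast
  then obtain g where g: "g \<in> \<Gamma>" "x = g *v L u"
    using orb_sym[OF u(2)] by (auto simp: orb_def)
  show ?thesis
  proof (cases "u \<in> half_disc")
    case True
    then show ?thesis using g by blast
  next
    case False
    then obtain h t where "h \<in> \<Gamma>" "t \<in> {0..1}" "L u = h *v L (upper_arc t)"
      using circle_cover[of u] u by (auto simp: half_disc_iff)
    then show ?thesis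
      using g mult[of g h] by (intro bexI[of _ "g ** h"] bexI[of _ "upper_arc t"])
        (auto simp: matrix_vector_mul_assoc half_disc_def)
  qed
qed

section \<open>Cells of the fundamental domain\<close>

text \<open>Parameters of the vertices. Besides the ends of the arc, every singular point must be a
  vertex: a rotation fixing a point inside an open edge would map that edge to itself and hence have
  to fix infinitely many points.\<close>

definition marks :: "real set"
  where "marks = {0, 1} \<union> {t \<in> {0..1}. L (upper_arc t) \<in> singular_points}"

lemma marks_unit: "marks \<subseteq> {0..1}"
  by (auto simp: marks_def)

lemma finite_marks: "finite marks"
proof -
  have "finite {t \<in> {0..1}. L (upper_arc t) \<in> singular_points}"
  proof (rule finite_imageD)
    show "inj_on upper_arc {t \<in> {0..1}. L (upper_arc t) \<in> singular_points}"
      using upper_arc_inj by (auto simp: inj_on_def)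
    show "finite (upper_arc ` {t \<in> {0..1}. L (upper_arc t) \<in> singular_points})"
      by (rule finite_subset[OF _ L_singular(1)]) auto
  qed
  then show ?thesis by (simp add: marks_def)
qed

definition gaps :: "(real \<times> real) set"
  where "gaps = {(a, b). a \<in> marks \<and> b \<in> marks \<and> a < b \<and> {a<..<b} \<inter> marks = {}}"

lemma gap_exists:
  assumes "t \<in> {0..1}" "t \<notin> marks"
  obtains a b where "(a, b) \<in> gaps" "a < t" "t < b"
proof -
  define A where "A = {m \<in> marks. m < t}"
  define B where "B = {m \<in> marks. m > t}"
  have "0 \<in> marks" "1 \<in> marks" by (auto simp: marks_def)
  then have "0 \<in> A" "1 \<in> B" using assms by (auto simp: A_def B_def less_le)
  then have ne: "A \<noteq> {}" "B \<noteq> {}" by auto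
  have f: "finite A" "finite B" using finite_marks by (auto simp: A_def B_def)
  define a b where "a = Max A" and "b = Min B"
  have "a \<in> A" "b \<in> B" unfolding a_def b_def using ne f by auto
  then have ab: "a \<in> marks" "b \<in> marks" "a < t" "t < b" by (simp_all add: A_def B_def)
  have "m \<notin> marks" if m: "a < m" "m < b" for m
  proof
    assume "m \<in> marks"
    then have "m \<in> A \<or> m \<in> B" using assms(2) by (cases m t rule: linorder_cases) (auto simp: A_def B_def)
    then show False using Max_ge[OF f(1), of m] Min_le[OF f(2), of m] m unfolding a_def b_def by linarith
  qed
  then have "(a, b) \<in> gaps" using ab by (auto simp: gaps_def)
  then show thesis using ab(3,4) by (rule that)
qed

lemma gap_unique:
  assumes "(a, b) \<in> gaps" "(c, d) \<in> gaps" "t \<in> {a<..<b}" "t \<in> {c<..<d}"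
  shows "a = c \<and> b = d"
proof -
  have "\<not> c \<in> {a<..<b}" "\<not> a \<in> {c<..<d}" "\<not> d \<in> {a<..<b}" "\<not> b \<in> {c<..<d}"
    using assms(1,2) unfolding gaps_def by blast+
  then show ?thesis using assms(3,4) by auto
qed

lemma gap_unit: "(a, b) \<in> gaps \<Longrightarrow> {a..b} \<subseteq> {0..1}"
  using marks_unit by (auto simp: gaps_def)

lemma gap_marks: "(a, b) \<in> gaps \<Longrightarrow> {a<..<b} \<inter> marks = {}"
  by (auto simp: gaps_def)

definition base_cells :: "nat \<Rightarrow> complex set set"
  where "base_cells n = (if n = 0 then (\<lambda>t. {upper_arc t}) ` marks
    else if n = 1 then (\<lambda>(a, b). upper_arc ` {a<..<b}) ` gaps
    else if n = 2 then {ball 0 1} else {})"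

lemma base_cells_cases:
  assumes "c \<in> base_cells n"
  obtains (0) t where "n = 0" "t \<in> marks" "c = {upper_arc t}"
  | (1) a b where "n = 1" "(a, b) \<in> gaps" "c = upper_arc ` {a<..<b}"
  | (2) "n = 2" "c = ball 0 1"
  using assms by (auto simp: base_cells_def split: if_splits)

lemma finite_base_cells: "finite (base_cells n)"
proof -
  have "gaps \<subseteq> marks \<times> marks" by (auto simp: gaps_def)
  then have "finite gaps" using finite_marks by (meson finite_SigmaI finite_subset)
  then show ?thesis using finite_marks by (auto simp: base_cells_def)
qed

lemma base_cell_half_disc: "c \<in> base_cells n \<Longrightarrow> c \<subseteq> half_disc"
proof (erule base_cells_cases)
  fix a b assume "(a, b) \<in> gaps" "c = upper_arc ` {a<..<b}"
  then show ?thesis using gap_unit[of a b] by (auto simp: half_disc_def)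
next
  fix t assume "t \<in> marks" "c = {upper_arc t}"
  then show ?thesis using marks_unit by (auto simp: half_disc_def)
qed (auto simp: half_disc_def)

lemma base_cell_disjoint:
  assumes "c \<in> base_cells m" "d \<in> base_cells n" "u \<in> c" "u \<in> d"
  shows "m = n \<and> c = d"
proof -
  have A: False if s: "s \<in> marks" and ab: "(a, b) \<in> gaps" and u: "upper_arc s \<in> upper_arc ` {a<..<b}" for s a b
  proof -
    obtain t where t: "t \<in> {a<..<b}" "upper_arc s = upper_arc t" using u by auto
    moreover have "t \<in> {0..1}" "s \<in> {0..1}" using t gap_unit[OF ab] s marks_unit by auto
    ultimately have "s = t" using upper_arc_inj by blast
    then show False using t s gap_marks[OF ab] by blast
  qed
  have B: "(a, b) = (c, d)" if gaps: "(a, b) \<in> gaps" "(c, d) \<in> gaps" and u: "u \<in> upper_arc ` {a<..<b}" "u \<in> upper_arc ` {c<..<d}"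
    for a b c d
  proof -
    obtain s t where st: "s \<in> {a<..<b}" "t \<in> {c<..<d}" "upper_arc s = upper_arc t" using u by auto
    moreover have "t \<in> {0..1}" "s \<in> {0..1}" using st gap_unit[OF gaps(1)] gap_unit[OF gaps(2)] by auto
    ultimately have "s = t" using upper_arc_inj by blast
    then show ?thesis using gap_unique[OF gaps] st by blast
  qed
  show ?thesis
    using assms(1)
  proof (cases rule: base_cells_cases)
    case m: (0 s)
    show ?thesis using assms(2)
      by (cases rule: base_cells_cases) (use m assms(3,4) A in auto)
  next
    case m: (1 a b)
    show ?thesis using assms(2)
    proof (cases rule: base_cells_cases)
      case n: (1 a' b')
      then show ?thesis using m assms(3,4) B[of a b a' b'] by auto
    qed (use m assms(3,4) A in auto)
  next
    case m: 2
    show ?thesis using assms(2)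
      by (cases rule: base_cells_cases) (use m assms(3,4) in auto)
  qed
qed

text \<open>Cells of positive dimension consist of points with trivial stabiliser; thus a point of a
  translated cell determines the group element that moved it.\<close>

lemma base_cell_regular:
  assumes "c \<in> base_cells n" "n > 0" "u \<in> c"
  shows "L u \<notin> singular_points"
  using assms(1)
proof (cases rule: base_cells_cases)
  case (1 a b)
  then obtain t where t: "t \<in> {a<..<b}" "u = upper_arc t" using assms(3) by auto
  then have "t \<in> {0..1}" "t \<notin> marks" using gap_unit[OF 1(2)] gap_marks[OF 1(2)] by auto
  then show ?thesis using t by (auto simp: marks_def)
next
  case 2
  then have "cmod u < 1" using assms(3) by simp
  then have "u \<notin> sphere 0 1" "u \<in> cball 0 1" by auto
  then show ?thesis using L_singular(2) by blast
qed (use assms in auto)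

lemma arc_in_base_cell:
  assumes "t \<in> {0..1}"
  shows "\<exists>n\<le>1. \<exists>c\<in>base_cells n. upper_arc t \<in> c"
proof (cases "t \<in> marks")
  case True
  then show ?thesis by (intro exI[of _ 0]) (auto simp: base_cells_def)
next
  case False
  then obtain a b where "(a, b) \<in> gaps" "a < t" "t < b" using gap_exists assms by blast
  then have "upper_arc ` {a<..<b} \<in> base_cells 1" "upper_arc t \<in> upper_arc ` {a<..<b}"
    by (auto simp: base_cells_def)
  then show ?thesis by blast
qed

lemma half_disc_in_base_cell:
  assumes "u \<in> half_disc"
  shows "\<exists>n. \<exists>c\<in>base_cells n. u \<in> c"
  using assms unfolding half_disc_def
proof
  assume "u \<in> ball 0 1"
  then show ?thesis by (intro exI[of _ 2]) (auto simp: base_cells_def)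
qed (use arc_in_base_cell in blast)


text \<open>The disjunction serves injectivity modulo orbits. An edge stays in
  \<open>half_disc\<close> together with its ends; the closed 2-disc does not, but its open cell
  avoids the circle. The boundary is described up to translation because the lower semicircle lies
  over translates of the upper one.\<close>

lemma base_cell_characteristic_map:
  assumes "c \<in> base_cells n"
  obtains \<kappa> where "continuous_on (disc_points n) \<kappa>" "\<kappa> ` disc_points n \<subseteq> cball 0 1"
    "\<kappa> ` {x \<in> disc_points n. (\<Sum>i<n. (x i)\<^sup>2) < 1} = c"
    "inj_on \<kappa> (disc_points n)"
    "c \<subseteq> ball 0 1 \<or> \<kappa> ` disc_points n \<subseteq> half_disc"
    "\<And>x. x \<in> disc_points n \<Longrightarrow> \<not> (\<Sum>i<n. (x i)\<^sup>2) < 1 \<Longrightarrow>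
      \<exists>g\<in>\<Gamma>. \<exists>k<n. \<exists>d\<in>base_cells k. \<exists>v\<in>d. L (\<kappa> x) = g *v L v"
  using assms
proof (cases rule: base_cells_cases)
  case (0 t)
  \<comment> \<open>The empty sum makes the open and the closed 0-disc the same point, so that a
    vertex has no boundary.\<close>
  have eq: "disc_points n = {\<lambda>_. 0}" "disc_points 0 = {\<lambda>_. 0}" using 0 by (auto simp: disc_points_def)
  show thesis
  proof (rule that[of "\<lambda>_. upper_arc t"])
    show "c \<subseteq> ball 0 1 \<or> (\<lambda>_. upper_arc t) ` disc_points n \<subseteq> half_disc"
      using base_cell_half_disc[OF assms] 0 by auto
  qed (use 0 in \<open>auto simp: eq\<close>)
next
  case (1 a b)
  define \<tau> where "\<tau> r = (a + b) / 2 + (b - a) / 2 * r" for r :: real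
  have ab: "a < b" using 1 by (auto simp: gaps_def)
  have \<tau>: "\<tau> r \<in> {a..b} \<longleftrightarrow> r \<in> {-1..1}" "\<tau> r \<in> {a<..<b} \<longleftrightarrow> r \<in> {-1<..<1}" for r
  proof -
    have e: "\<tau> r - a = (b - a) / 2 * (r + 1)" "b - \<tau> r = (b - a) / 2 * (1 - r)"
      by (simp_all add: \<tau>_def field_simps)
    have "a \<le> \<tau> r \<longleftrightarrow> -1 \<le> r" "\<tau> r \<le> b \<longleftrightarrow> r \<le> 1" "a < \<tau> r \<longleftrightarrow> -1 < r" "\<tau> r < b \<longleftrightarrow> r < 1"
      using arg_cong[OF e(1), of "\<lambda>z. 0 \<le> z"] arg_cong[OF e(2), of "\<lambda>z. 0 \<le> z"]
        arg_cong[OF e(1), of "\<lambda>z. 0 < z"] arg_cong[OF e(2), of "\<lambda>z. 0 < z"] ab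
      by (auto simp: zero_le_mult_iff zero_less_mult_iff)
    then show "\<tau> r \<in> {a..b} \<longleftrightarrow> r \<in> {-1..1}" "\<tau> r \<in> {a<..<b} \<longleftrightarrow> r \<in> {-1<..<1}" by auto
  qed
  have \<tau>_inj: "\<tau> r = \<tau> s \<longleftrightarrow> r = s" for r s using ab by (simp add: \<tau>_def)
  have D: "disc_points n = {x. (\<forall>i\<ge>1. x i = 0) \<and> x 0 \<in> {-1..1}}"
    using 1 by (auto simp: disc_points_def abs_square_le_1 abs_le_iff)
  have lt: "(\<Sum>i<n. (x i)\<^sup>2) < 1 \<longleftrightarrow> x 0 \<in> {-1<..<1}" for x :: "nat \<Rightarrow> real"
    using 1 by (auto simp: abs_square_less_1 abs_less_iff)
  have unit: "\<tau> (x 0) \<in> {0..1}" if "x \<in> disc_points n" for x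
    using that \<tau>(1)[of "x 0"] gap_unit[OF 1(2)] by (auto simp: D)
  show thesis
  proof (rule that[of "\<lambda>x. upper_arc (\<tau> (x 0))"])
    show "continuous_on (disc_points n) (\<lambda>x. upper_arc (\<tau> (x 0)))"
      unfolding \<tau>_def by (intro continuous_intros continuous_on_subset[OF continuous_on_product_coordinates subset_UNIV])
    show "(\<lambda>x. upper_arc (\<tau> (x 0))) ` disc_points n \<subseteq> cball 0 1" by auto
    show "c \<subseteq> ball 0 1 \<or> (\<lambda>x. upper_arc (\<tau> (x 0))) ` disc_points n \<subseteq> half_disc"
      using unit unfolding half_disc_def by blast
    show "inj_on (\<lambda>x. upper_arc (\<tau> (x 0))) (disc_points n)"
    proof
      fix x y assume xy: "x \<in> disc_points n" "y \<in> disc_points n" "upper_arc (\<tau> (x 0)) = upper_arc (\<tau> (y 0))"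
      then have "x 0 = y 0" using upper_arc_inj unit \<tau>_inj by blast
      show "x = y"
      proof
        fix i show "x i = y i" using xy(1,2) \<open>x 0 = y 0\<close> by (cases "i = 0") (auto simp: D)
      qed
    qed
    show "(\<lambda>x. upper_arc (\<tau> (x 0))) ` {x \<in> disc_points n. (\<Sum>i<n. (x i)\<^sup>2) < 1} = c"
    proof
      show "(\<lambda>x. upper_arc (\<tau> (x 0))) ` {x \<in> disc_points n. (\<Sum>i<n. (x i)\<^sup>2) < 1} \<subseteq> c"
        unfolding lt 1(3) using \<tau>(2) by blast
      show "c \<subseteq> (\<lambda>x. upper_arc (\<tau> (x 0))) ` {x \<in> disc_points n. (\<Sum>i<n. (x i)\<^sup>2) < 1}"
      proof
        fix u assume "u \<in> c"
        then obtain t where t: "t \<in> {a<..<b}" "u = upper_arc t" using 1 by auto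
        define r where "r = (t - (a + b) / 2) / ((b - a) / 2)"
        have "(b - a) / 2 \<noteq> 0" using ab by simp
        then have "(b - a) / 2 * r = t - (a + b) / 2"
          unfolding r_def times_divide_eq_right by (rule nonzero_mult_div_cancel_left)
        then have r: "\<tau> r = t" unfolding \<tau>_def by linarith
        then have "r \<in> {-1<..<1}" using \<tau>(2)[of r] t by simp
        then show "u \<in> (\<lambda>x. upper_arc (\<tau> (x 0))) ` {x \<in> disc_points n. (\<Sum>i<n. (x i)\<^sup>2) < 1}"
          unfolding lt by (intro image_eqI[of _ _ "\<lambda>i. if i = 0 then r else 0"]) (auto simp: D r t)
      qed
    qed
    fix x assume x: "x \<in> disc_points n" "\<not> (\<Sum>i<n. (x i)\<^sup>2) < 1"
    then have "\<tau> (x 0) \<in> {a..b}" "\<tau> (x 0) \<notin> {a<..<b}"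
      using \<tau>[of "x 0"] by (auto simp: D lt)
    then have "\<tau> (x 0) \<in> marks" using 1(2) by (auto simp: gaps_def le_less)
    then have "{upper_arc (\<tau> (x 0))} \<in> base_cells 0" by (auto simp: base_cells_def)
    moreover have "L (upper_arc (\<tau> (x 0))) = mat 1 *v L (upper_arc (\<tau> (x 0)))" by simp
    ultimately show "\<exists>g\<in>\<Gamma>. \<exists>k<n. \<exists>d\<in>base_cells k. \<exists>v\<in>d. L (upper_arc (\<tau> (x 0))) = g *v L v"
      using one 1(1) by (metis insertI1 zero_less_one)
  qed
next
  case 2
  have D: "disc_points n = {x. (\<forall>i\<ge>2. x i = 0) \<and> cmod (Complex (x 0) (x 1)) \<le> 1}"
    using 2 by (auto simp: disc_points_def numeral_2_eq_2 cmod_def)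
  have lt: "(\<Sum>i<n. (x i)\<^sup>2) < 1 \<longleftrightarrow> cmod (Complex (x 0) (x 1)) < 1" for x :: "nat \<Rightarrow> real"
    using 2 by (auto simp: numeral_2_eq_2 cmod_def)
  show thesis
  proof (rule that[of "\<lambda>x. Complex (x 0) (x 1)"])
    show "continuous_on (disc_points n) (\<lambda>x. Complex (x 0) (x 1))"
      unfolding Complex_eq by (intro continuous_intros continuous_on_subset[OF continuous_on_product_coordinates subset_UNIV])
    show "(\<lambda>x. Complex (x 0) (x 1)) ` disc_points n \<subseteq> cball 0 1" by (auto simp: D)
    show "c \<subseteq> ball 0 1 \<or> (\<lambda>x. Complex (x 0) (x 1)) ` disc_points n \<subseteq> half_disc" using 2 by simp
    show "inj_on (\<lambda>x. Complex (x 0) (x 1)) (disc_points n)"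
    proof
      fix x y assume xy: "x \<in> disc_points n" "y \<in> disc_points n" "Complex (x 0) (x 1) = Complex (y 0) (y 1)"
      show "x = y"
      proof
        fix i :: nat consider "i = 0" | "i = 1" | "i \<ge> 2" by linarith
        then show "x i = y i" using xy by cases (auto simp: D)
      qed
    qed
    show "(\<lambda>x. Complex (x 0) (x 1)) ` {x \<in> disc_points n. (\<Sum>i<n. (x i)\<^sup>2) < 1} = c"
    proof
      show "(\<lambda>x. Complex (x 0) (x 1)) ` {x \<in> disc_points n. (\<Sum>i<n. (x i)\<^sup>2) < 1} \<subseteq> c"
        unfolding lt 2(2) by auto
      show "c \<subseteq> (\<lambda>x. Complex (x 0) (x 1)) ` {x \<in> disc_points n. (\<Sum>i<n. (x i)\<^sup>2) < 1}"
      proof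
        fix u assume "u \<in> c"
        then have "cmod u < 1" using 2 by simp
        then show "u \<in> (\<lambda>x. Complex (x 0) (x 1)) ` {x \<in> disc_points n. (\<Sum>i<n. (x i)\<^sup>2) < 1}"
          unfolding lt
          by (intro image_eqI[of _ _ "\<lambda>i. if i = 0 then Re u else if i = 1 then Im u else 0"]) (auto simp: D)
      qed
    qed
    fix x assume x: "x \<in> disc_points n" "\<not> (\<Sum>i<n. (x i)\<^sup>2) < 1"
    then have "cmod (Complex (x 0) (x 1)) = 1" by (auto simp: D lt)
    \<comment> \<open>The boundary of the 2-cell is carried into translates of the upper arc, hence
      into vertices and edges.\<close>
    then obtain g t where gt: "g \<in> \<Gamma>" "t \<in> {0..1}" "L (Complex (x 0) (x 1)) = g *v L (upper_arc t)"
      using circle_cover by blast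
    obtain k d where kd: "k \<le> 1" "d \<in> base_cells k" "upper_arc t \<in> d"
      using arc_in_base_cell[OF gt(2)] by blast
    then have "k < n" using 2 by simp
    then show "\<exists>g\<in>\<Gamma>. \<exists>k<n. \<exists>d\<in>base_cells k. \<exists>v\<in>d. L (Complex (x 0) (x 1)) = g *v L v"
      using gt kd by blast
  qed
qed

section \<open>Translating the cells over the sphere\<close>

definition cell :: "real^3^3 \<Rightarrow> complex set \<Rightarrow> (real^3) set"
  where "cell g c = (\<lambda>u. g *v L u) ` c"

text \<open>A set of sets, so that the coinciding translates of a vertex with nontrivial stabiliser
  count only once.\<close>

definition cells :: "nat \<Rightarrow> (real^3) set set"
  where "cells n = (\<lambda>(g, c). cell g c) ` (\<Gamma> \<times> base_cells n)"

lemma cells_iff: "e \<in> cells n \<longleftrightarrow> (\<exists>g\<in>\<Gamma>. \<exists>c\<in>base_cells n. e = cell g c)"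
  by (auto simp: cells_def)

lemma finite_cells: "finite (cells n)"
  using fin finite_base_cells by (simp add: cells_def)

lemma cells_empty: "n > 2 \<Longrightarrow> cells n = {}"
  by (simp add: cells_def base_cells_def)

lemma gL_sphere: "g \<in> \<Gamma> \<Longrightarrow> cmod u \<le> 1 \<Longrightarrow> g *v L u \<in> sphere 0 1"
  using L_sphere by (auto simp: image_subset_iff)

lemma cell_sphere:
  assumes "e \<in> cells n"
  shows "e \<subseteq> sphere 0 1"
proof -
  obtain g c where gc: "g \<in> \<Gamma>" "c \<in> base_cells n" "e = cell g c"
    using assms by (auto simp: cells_iff)
  then have "c \<subseteq> half_disc" using base_cell_half_disc by blast
  then show ?thesis
    unfolding gc(3) cell_def using gL_sphere[OF gc(1)] half_disc_iff by blast
qed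

lemma cells_cover: "(\<Union>n. \<Union>(cells n)) = sphere 0 1"
proof
  show "(\<Union>n. \<Union>(cells n)) \<subseteq> sphere 0 1" using cell_sphere by blast
  show "sphere 0 1 \<subseteq> (\<Union>n. \<Union>(cells n))"
  proof
    fix x :: "real^3" assume "x \<in> sphere 0 1"
    then obtain g u where gu: "g \<in> \<Gamma>" "u \<in> half_disc" "x = g *v L u"
      using half_disc_cover by blast
    then obtain n c where "c \<in> base_cells n" "u \<in> c" using half_disc_in_base_cell by blast
    then have "cell g c \<in> cells n" "x \<in> cell g c"
      using gu by (auto simp: cells_iff cell_def)
    then show "x \<in> (\<Union>n. \<Union>(cells n))" by blast
  qed
qed

lemma cells_disjoint:
  assumes "d \<in> cells m" "e \<in> cells n" "x \<in> d" "x \<in> e"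
  shows "m = n \<and> d = e"
proof -
  obtain g c where gc: "g \<in> \<Gamma>" "c \<in> base_cells m" "d = cell g c"
    using assms by (auto simp: cells_iff)
  obtain h c' where hc: "h \<in> \<Gamma>" "c' \<in> base_cells n" "e = cell h c'"
    using assms by (auto simp: cells_iff)
  obtain u v where uv: "u \<in> c" "v \<in> c'" "x = g *v L u" "x = h *v L v"
    using assms gc hc by (auto simp: cell_def)
  have uK: "u \<in> half_disc" "v \<in> half_disc"
    using uv gc hc base_cell_half_disc by blast+
  then have "u = v" using half_disc_inj[OF _ _ gc(1) hc(1)] uv by simp
  then have mn: "m = n" "c = c'" using base_cell_disjoint[OF gc(2) hc(2)] uv by auto
  moreover have "cell g c = cell h c'"
  \<comment> \<open>A vertex is the common point itself, whatever rotation produced it; in positive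
    dimension the common point is regular and forces the rotations to agree.\<close>
  proof (cases "m = 0")
    case True
    then have "c = {u}" using gc(2) uv(1) by (auto simp: base_cells_def)
    then show ?thesis using mn uv \<open>u = v\<close> by (simp add: cell_def)
  next
    case False
    then have "L u \<notin> singular_points" using base_cell_regular[OF gc(2)] uv by simp
    moreover have "L u \<in> sphere 0 1"
      using L_sphere uK(1) by (auto simp: half_disc_iff image_subset_iff)
    ultimately have "g = h"
      using act_inj_regular[OF _ _ gc(1) hc(1)] uv \<open>u = v\<close> by simp
    then show ?thesis using mn by simp
  qed
  ultimately show ?thesis using gc hc by simp
qed

lemma cell_characteristic_map:
  assumes "e \<in> cells n"
  shows "\<exists>f. continuous_map (closed_disc n) (top_of_set (sphere 0 1)) f \<and>
        homeomorphic_map (open_disc n) (subtopology (top_of_set (sphere 0 1)) e) f \<and>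
        (\<exists>\<F>. finite \<F> \<and> \<F> \<subseteq> (\<Union>k<n. cells k) \<and>
              f ` (topspace (closed_disc n) - topspace (open_disc n)) \<subseteq> \<Union>\<F>)"
proof -
  obtain g c where gc: "g \<in> \<Gamma>" "c \<in> base_cells n" "e = cell g c"
    using assms by (auto simp: cells_iff)
  obtain \<kappa> where \<kappa>: "continuous_on (disc_points n) \<kappa>" "\<kappa> ` disc_points n \<subseteq> cball 0 1"
    "\<kappa> ` {x \<in> disc_points n. (\<Sum>i<n. (x i)\<^sup>2) < 1} = c"
    "inj_on \<kappa> (disc_points n)"
    "c \<subseteq> ball 0 1 \<or> \<kappa> ` disc_points n \<subseteq> half_disc"
    "\<And>x. x \<in> disc_points n \<Longrightarrow> \<not> (\<Sum>i<n. (x i)\<^sup>2) < 1 \<Longrightarrow>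
      \<exists>g\<in>\<Gamma>. \<exists>k<n. \<exists>d\<in>base_cells k. \<exists>v\<in>d. L (\<kappa> x) = g *v L v"
    using base_cell_characteristic_map[OF gc(2)] by blast
  define f where "f x = g *v L (\<kappa> x)" for x
  let ?O = "{x \<in> disc_points n. (\<Sum>i<n. (x i)\<^sup>2) < 1}"
  have e: "e = f ` ?O"
    unfolding gc(3) cell_def f_def \<kappa>(3)[symmetric] image_image ..
  have "continuous_on (disc_points n) f"
    unfolding f_def
    by (intro bounded_linear.continuous_on[OF matrix_vector_mul_bounded_linear] continuous_on_compose2[OF L_cont \<kappa>(1,2)])
  moreover have "f ` disc_points n \<subseteq> sphere 0 1"
    unfolding f_def using gL_sphere[OF gc(1)] \<kappa>(2) by (auto simp: image_subset_iff)
  ultimately have cont: "continuous_map (closed_disc n) (top_of_set (sphere 0 1)) f"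
    unfolding closed_disc_eq by (simp add: image_subset_iff_funcset)
  have inj: "x = y" if "x \<in> ?O" "y \<in> topspace (closed_disc n)" "f x = f y" for x y
  proof -
    have xy: "x \<in> disc_points n" "y \<in> disc_points n" "\<kappa> x \<in> c"
      using that \<kappa>(3) by (auto simp: topspace_closed_disc)
    have eq: "L (\<kappa> x) = L (\<kappa> y)" using that(3) act_eq_iff[OF gc(1)] by (simp add: f_def)
    \<comment> \<open>Only conjugate points of the circle can collide. The open disc contains no
      such point, and the half disc contains both only if they coincide.\<close>
    then have "\<kappa> y = \<kappa> x \<or> cmod (\<kappa> x) = 1 \<and> \<kappa> y = cnj (\<kappa> x)"
      using L_inj[of "\<kappa> x" "\<kappa> y"] subsetD[OF \<kappa>(2)] xy by simp
    moreover have "\<kappa> x = \<kappa> y" if "\<kappa> ` disc_points n \<subseteq> half_disc"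
      using half_disc_inj[OF _ _ one one, of "\<kappa> x" "\<kappa> y"] eq that xy by auto
    ultimately have "\<kappa> x = \<kappa> y" using \<kappa>(5) xy(3) by auto
    then show ?thesis using \<kappa>(4) xy by (auto simp: inj_on_def)
  qed
  have homeo: "homeomorphic_map (open_disc n) (subtopology (top_of_set (sphere 0 1)) e) f"
    unfolding open_disc_eq e
    by (rule homeomorphic_map_onto_image[OF compact_space_closed_disc _ cont _ inj])
      (auto simp: topspace_closed_disc Hausdorff_space_subtopology)
  have \<F>: "finite (\<Union>k<n. cells k)" using finite_cells by auto
  have "f ` (topspace (closed_disc n) - topspace (open_disc n)) \<subseteq> \<Union>(\<Union>k<n. cells k)"
  proof
    fix y assume "y \<in> f ` (topspace (closed_disc n) - topspace (open_disc n))"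
    then obtain x where x: "x \<in> disc_points n" "\<not> (\<Sum>i<n. (x i)\<^sup>2) < 1" "y = f x"
      by (auto simp: topspace_closed_disc topspace_open_disc)
    obtain h k d v where h: "h \<in> \<Gamma>" "k < n" "d \<in> base_cells k" "v \<in> d" "L (\<kappa> x) = h *v L v"
      using \<kappa>(6)[OF x(1,2)] by blast
    have "y = (g ** h) *v L v" using h x(3) by (simp add: f_def matrix_vector_mul_assoc)
    then have "y \<in> cell (g ** h) d" using h(4) by (simp add: cell_def)
    moreover have "cell (g ** h) d \<in> cells k" using h mult[OF gc(1) h(1)] by (auto simp: cells_iff)
    ultimately show "y \<in> \<Union>(\<Union>k<n. cells k)" using h(2) by blast
  qed
  with \<F> cont homeo show ?thesis by blast
qed

lemma cw_decomposition_cells: "cw_decomposition (top_of_set (sphere 0 1)) cells"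
  unfolding cw_decomposition_def
proof (intro conjI allI ballI impI)
  show "Hausdorff_space (top_of_set (sphere 0 1 :: (real^3) set))"
    by (simp add: Hausdorff_space_subtopology)
  show "(\<Union>n. \<Union>(cells n)) = topspace (top_of_set (sphere 0 1))" by (simp add: cells_cover)
  show "d \<inter> e = {}" if "d \<in> cells m" "e \<in> cells n" "m \<noteq> n \<or> d \<noteq> e" for m n d e
    using cells_disjoint[OF that(1,2)] that(3) by blast
  show "\<exists>f. continuous_map (closed_disc n) (top_of_set (sphere 0 1)) f \<and>
        homeomorphic_map (open_disc n) (subtopology (top_of_set (sphere 0 1)) e) f \<and>
        (\<exists>\<F>. finite \<F> \<and> \<F> \<subseteq> (\<Union>k<n. cells k) \<and>
              f ` (topspace (closed_disc n) - topspace (open_disc n)) \<subseteq> \<Union>\<F>)"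
    if "e \<in> cells n" for n e by (rule cell_characteristic_map[OF that])
  fix C :: "(real^3) set"
  assume C: "C \<subseteq> topspace (top_of_set (sphere 0 1))"
    and cl: "\<forall>n. \<forall>e\<in>cells n. closedin (top_of_set (sphere 0 1)) (C \<inter> top_of_set (sphere 0 1) closure_of e)"
  let ?T = "top_of_set (sphere 0 1 :: (real^3) set)"
  let ?E = "\<Union>n\<le>2. cells n"
  have fE: "finite ?E" using finite_cells by auto
  \<comment> \<open>With finitely many cells, the weak topology condition reduces to a finite union
    of closed sets.\<close>
  have "C = (\<Union>e\<in>?E. C \<inter> ?T closure_of e)"
  proof
    show "C \<subseteq> (\<Union>e\<in>?E. C \<inter> ?T closure_of e)"
    proof
      fix x assume x: "x \<in> C"
      then have "x \<in> (\<Union>n. \<Union>(cells n))" using C unfolding cells_cover by auto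
      then obtain n e where e: "e \<in> cells n" "x \<in> e" by blast
      then have "n \<le> 2" using cells_empty[of n] by (metis empty_iff not_le)
      moreover have "x \<in> ?T closure_of e"
        using closure_of_subset[of e ?T] cell_sphere[OF e(1)] e(2) by auto
      ultimately show "x \<in> (\<Union>e\<in>?E. C \<inter> ?T closure_of e)" using e x by blast
    qed
  qed blast
  moreover have "closedin ?T (\<Union>e\<in>?E. C \<inter> ?T closure_of e)"
    using fE cl by (intro closedin_Union) auto
  ultimately show "closedin ?T C" by simp
qed

text \<open>A base cell meets each orbit at most once, so an element that maps a cell to itself
  cannot move any point within it.\<close>

lemma act_cell:
  assumes g: "g \<in> \<Gamma>" and e: "e \<in> cells n"
  shows "(*v) g ` e \<in> cells n" "(*v) g ` e = e \<Longrightarrow> x \<in> e \<Longrightarrow> g *v x = x"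
proof -
  obtain h c where hc: "h \<in> \<Gamma>" "c \<in> base_cells n" "e = cell h c"
    using e by (auto simp: cells_iff)
  have "(*v) g ` e = cell (g ** h) c"
    unfolding hc(3) cell_def by (simp add: image_image matrix_vector_mul_assoc)
  then show "(*v) g ` e \<in> cells n" using mult[OF g hc(1)] hc(2) by (auto simp: cells_iff)
  assume ge: "(*v) g ` e = e" and x: "x \<in> e"
  obtain u where u: "u \<in> c" "x = h *v L u" using x hc by (auto simp: cell_def)
  have "g *v x \<in> e" using ge x by blast
  then obtain v where v: "v \<in> c" "g *v x = h *v L v" using hc by (auto simp: cell_def)
  have "(g ** h) *v L u = h *v L v" using u v by (simp flip: matrix_vector_mul_assoc)
  then have "u = v"
    using half_disc_inj[OF _ _ mult[OF g hc(1)] hc(1)] base_cell_half_disc[OF hc(2)] u v by blast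
  then show "g *v x = x" using u v by simp
qed

lemma skeleton_cells: "skeleton cells 1 = {g *v L (upper_arc t) | g t. g \<in> \<Gamma> \<and> t \<in> {0..1}}"
proof
  show "skeleton cells 1 \<subseteq> {g *v L (upper_arc t) | g t. g \<in> \<Gamma> \<and> t \<in> {0..1}}"
  proof
    fix x assume "x \<in> skeleton cells 1"
    then obtain n g c u where n: "n \<le> 1" "g \<in> \<Gamma>" "c \<in> base_cells n" "u \<in> c" "x = g *v L u"
      by (auto simp: skeleton_def cells_iff cell_def)
    have "\<exists>t\<in>{0..1}. u = upper_arc t"
      using n(3)
    proof (cases rule: base_cells_cases)
      case (0 t)
      then show ?thesis using n marks_unit by auto
    next
      case (1 a b)
      then show ?thesis using n gap_unit[OF 1(2)] by auto
    qed (use n in auto)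
    then show "x \<in> {g *v L (upper_arc t) | g t. g \<in> \<Gamma> \<and> t \<in> {0..1}}" using n by blast
  qed
  show "{g *v L (upper_arc t) | g t. g \<in> \<Gamma> \<and> t \<in> {0..1}} \<subseteq> skeleton cells 1"
  proof
    fix x assume "x \<in> {g *v L (upper_arc t) | g t. g \<in> \<Gamma> \<and> t \<in> {0..1}}"
    then obtain g t where gt: "g \<in> \<Gamma>" "t \<in> {0..1}" "x = g *v L (upper_arc t)" by blast
    then obtain n c where n: "n \<le> 1" "c \<in> base_cells n" "upper_arc t \<in> c"
      using arc_in_base_cell by blast
    then have "cell g c \<in> cells n" "x \<in> cell g c" using gt by (auto simp: cells_iff cell_def)
    then show "x \<in> skeleton cells 1" using n(1) unfolding skeleton_def by blast
  qed
qed

end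

section \<open>Sections over orbit spaces\<close>

lemma finite_rotation_groupI:
  assumes "subgroup \<Gamma> special_orthogonal_group" "finite \<Gamma>"
  shows "finite_rotation_group \<Gamma>"
proof
  interpret subgroup \<Gamma> special_orthogonal_group by fact
  show "finite \<Gamma>" by fact
  show rot: "rotation_matrix g" if "g \<in> \<Gamma>" for g
    using subset that by (auto simp: special_orthogonal_group_def)
  show "mat 1 \<in> \<Gamma>" using one_closed by (simp add: special_orthogonal_group_def)
  show "g ** h \<in> \<Gamma>" if "g \<in> \<Gamma>" "h \<in> \<Gamma>" for g h
    using m_closed[OF that] by (simp add: special_orthogonal_group_def)
  show "transpose g \<in> \<Gamma>" if g: "g \<in> \<Gamma>" for g
  proof -
    have c: "g \<in> carrier special_orthogonal_group" "transpose g \<in> carrier special_orthogonal_group"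
      using rot[OF g] by (auto simp: special_orthogonal_group_def rotation_matrix_def det_transpose)
    have "transpose g \<otimes>\<^bsub>special_orthogonal_group\<^esub> g = \<one>\<^bsub>special_orthogonal_group\<^esub>"
      using rot[OF g] by (simp add: special_orthogonal_group_def rotation_matrix_def orthogonal_matrix_def)
    then have "inv\<^bsub>special_orthogonal_group\<^esub> g = transpose g"
      using group.inv_equality[OF group_special_orthogonal_group] c by blast
    then show ?thesis using m_inv_closed[OF g] by simp
  qed
qed

context finite_rotation_group
begin

lemma group_rotation_subgroup:
  assumes "subgroup \<Gamma> special_orthogonal_group"
  shows "group (special_orthogonal_group\<lparr>carrier := \<Gamma>\<rparr>)"
  using subgroup.subgroup_is_group[OF assms group_special_orthogonal_group] .

lemma bij_rot_action:
  assumes A: "\<And>g. g \<in> \<Gamma> \<Longrightarrow> (*v) g ` A \<subseteq> A" and g: "g \<in> \<Gamma>"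
  shows "rot_action A g \<in> Bij A"
proof -
  have "bij_betw (\<lambda>x. g *v x) A A"
    by (rule bij_betw_byWitness[where f' = "\<lambda>x. transpose g *v x"])
      (use A[OF g] A[OF inv[OF g]] g in auto)
  then have "bij_betw (rot_action A g) A A"
    by (rule bij_betw_cong[THEN iffD1, rotated]) (simp add: rot_action_def)
  then show ?thesis
    by (simp add: Bij_def rot_action_def)
qed

lemma gamma_space_rot_action:
  assumes sub: "subgroup \<Gamma> special_orthogonal_group"
    and A: "\<And>g. g \<in> \<Gamma> \<Longrightarrow> (*v) g ` A \<subseteq> A"
  shows "gamma_space (special_orthogonal_group\<lparr>carrier := \<Gamma>\<rparr>) (top_of_set A) (rot_action A)"
  unfolding gamma_space_def
proof
  let ?G = "special_orthogonal_group\<lparr>carrier := \<Gamma>\<rparr> :: (real^3^3) monoid"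
  have "rot_action A \<in> hom ?G (BijGroup A)"
  proof (rule homI)
    fix g assume "g \<in> carrier ?G"
    then show "rot_action A g \<in> carrier (BijGroup A)"
      using bij_rot_action[OF A] by (simp add: BijGroup_def)
  next
    fix g h assume gh: "g \<in> carrier ?G" "h \<in> carrier ?G"
    have "rot_action A (g ** h) = compose A (rot_action A g) (rot_action A h)"
      using A[of h] gh by (auto simp: rot_action_def compose_def fun_eq_iff restrict_def matrix_vector_mul_assoc)
    then show "rot_action A (g \<otimes>\<^bsub>?G\<^esub> h) = rot_action A g \<otimes>\<^bsub>BijGroup A\<^esub> rot_action A h"
      using gh bij_rot_action[OF A] by (simp add: BijGroup_def special_orthogonal_group_def)
  qed
  then show "group_action ?G (topspace (top_of_set A)) (rot_action A)"
    using group_rotation_subgroup[OF sub] group_BijGroup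
    by (simp add: group_action_def group_hom_def group_hom_axioms_def)
  have "continuous_map (prod_topology (discrete_topology \<Gamma>) (top_of_set A)) (top_of_set A)
      (\<lambda>(g, x). rot_action A g x)" (is "continuous_map ?P _ ?f")
    unfolding continuous_map_def
  proof (intro conjI allI impI)
    show "?f \<in> topspace ?P \<rightarrow> topspace (top_of_set A)"
      using A by (auto simp: rot_action_def image_subset_iff)
    fix U assume U: "openin (top_of_set A) U"
    \<comment> \<open>The group is discrete, so the preimage splits into open slices, one for each
      rotation.\<close>
    have eq: "{p \<in> topspace ?P. ?f p \<in> U} = (\<Union>g\<in>\<Gamma>. {g} \<times> {x \<in> A. g *v x \<in> U})"
      by (auto simp: rot_action_def)
    have "openin ?P ({g} \<times> {x \<in> A. g *v x \<in> U})" if g: "g \<in> \<Gamma>" for g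
    proof -
      have "continuous_map (top_of_set A) (top_of_set A) (\<lambda>x. g *v x)"
        using A[OF g] by (auto intro: linear_continuous_on matrix_vector_mul_bounded_linear)
      then have "openin (top_of_set A) {x \<in> topspace (top_of_set A). g *v x \<in> U}"
        using U by (rule openin_continuous_map_preimage)
      then have "openin (top_of_set A) {x \<in> A. g *v x \<in> U}" by simp
      then show ?thesis using g by (simp add: openin_prod_Times_iff)
    qed
    then show "openin ?P {p \<in> topspace ?P. ?f p \<in> U}"
      unfolding eq by blast
  qed
  then show "continuous_map (prod_topology (discrete_topology (carrier ?G)) (top_of_set A)) (top_of_set A)
      (\<lambda>(g, x). rot_action A g x)" by simp
qed

lemma orbit_rot_action: "x \<in> A \<Longrightarrow> orbit (special_orthogonal_group\<lparr>carrier := \<Gamma>\<rparr>) (rot_action A) x = orb x"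
  by (auto simp: orbit_def orb_def rot_action_def)

lemma orb_eq: "y \<in> orb x \<Longrightarrow> orb y = orb x"
  using orb_sym orb_trans by blast

text \<open>By the quotient topology, continuity of the section amounts to continuity of the map
  sending a point to the representative of its orbit in \<open>T\<close>. The preimage of a closed
  set is a finite union of translates of a closed part of \<open>T\<close>, hence compact.\<close>

lemma split_gamma_space_transversal:
  assumes sub: "subgroup \<Gamma> special_orthogonal_group"
    and T: "compact T" "\<And>x y. x \<in> T \<Longrightarrow> y \<in> T \<Longrightarrow> y \<in> orb x \<Longrightarrow> x = y"
    and A: "A = (\<Union>g\<in>\<Gamma>. (*v) g ` T)"
  defines "G \<equiv> special_orthogonal_group\<lparr>carrier := \<Gamma>\<rparr>"
  shows "\<exists>\<phi>. split_gamma_space G (top_of_set A) (rot_action A)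
    (orbit_space G (top_of_set A) (rot_action A)) (orbit G (rot_action A)) \<phi>"
proof -
  let ?X = "top_of_set A"
  let ?\<pi> = "orbit G (rot_action A)"
  let ?Q = "orbit_space G ?X (rot_action A)"
  have act: "(*v) g ` A \<subseteq> A" if "g \<in> \<Gamma>" for g
    unfolding A using mult[OF that] by (force simp: matrix_vector_mul_assoc)
  have orb: "?\<pi> x = orb x" if "x \<in> A" for x
    unfolding G_def by (rule orbit_rot_action[OF that])
  have orbA: "orb x \<subseteq> A" if "x \<in> A" for x
    using act that by (auto simp: orb_def)
  have TA: "T \<subseteq> A" unfolding A using one by force
  have Q: "topspace ?Q = orb ` A"
    using orb by (auto simp: topspace_orbit_space orbits_def image_iff)
  define \<phi> where "\<phi> a = (THE y. y \<in> T \<and> y \<in> a)" for a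
  have \<phi>_eq: "\<phi> (orb x) = y" if "y \<in> T" "y \<in> orb x" for x y
    unfolding \<phi>_def using that T(2) orb_sym orb_trans by (intro the_equality) blast+
  have \<phi>: "\<phi> (orb x) \<in> T \<and> \<phi> (orb x) \<in> orb x" if x: "x \<in> A" for x
  proof -
    obtain g y where "g \<in> \<Gamma>" "y \<in> T" "x = g *v y" using x A by auto
    then have "y \<in> orb x" using orbI orb_sym by blast
    then show ?thesis using \<phi>_eq \<open>y \<in> T\<close> by metis
  qed
  have "continuous_map ?X ?X (\<phi> \<circ> ?\<pi>)"
    unfolding continuous_map_closedin
  proof (intro conjI allI impI)
    show "\<phi> \<circ> ?\<pi> \<in> topspace ?X \<rightarrow> topspace ?X"
      using \<phi> orb TA by auto
    fix C assume "closedin ?X C"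
    then obtain C' where C': "closed C'" "C = A \<inter> C'" by (auto simp: closedin_closed)
    have "{x \<in> topspace ?X. (\<phi> \<circ> ?\<pi>) x \<in> C} = (\<Union>g\<in>\<Gamma>. (*v) g ` (T \<inter> C'))" (is "?L = ?R")
    proof
      show "?L \<subseteq> ?R"
      proof
        fix x assume "x \<in> ?L"
        then have x: "x \<in> A" "\<phi> (orb x) \<in> C'" using orb C' by auto
        have "x \<in> orb (\<phi> (orb x))" using \<phi>[OF x(1)] orb_sym by blast
        then obtain g where "g \<in> \<Gamma>" "x = g *v \<phi> (orb x)" by (auto simp: orb_def)
        then show "x \<in> ?R" using \<phi>[OF x(1)] x(2) by blast
      qed
      show "?R \<subseteq> ?L"
      proof
        fix x assume "x \<in> ?R"
        then obtain g y where gy: "g \<in> \<Gamma>" "y \<in> T" "y \<in> C'" "x = g *v y" by auto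
        then have x: "x \<in> A" using A by blast
        have "\<phi> (orb x) = y" using \<phi>_eq[OF gy(2)] orb_sym orbI gy by blast
        then show "x \<in> ?L" using x gy TA C' orb by auto
      qed
    qed
    moreover have "compact ?R"
      using fin T(1) C'(1)
      by (intro compact_UN compact_continuous_image linear_continuous_on matrix_vector_mul_bounded_linear compact_Int_closed)
    moreover have "?R \<subseteq> A" unfolding A by blast
    ultimately show "closedin ?X {x \<in> topspace ?X. (\<phi> \<circ> ?\<pi>) x \<in> C}"
      by (simp add: closed_subset compact_imp_closed)
  qed
  then have cont: "continuous_map ?Q ?X \<phi>"
    using continuous_compose_quotient_map_eq[OF quotient_map_orbit] by blast
  have "split_gamma_space G ?X (rot_action A) ?Q ?\<pi> \<phi>"
    unfolding split_gamma_space_def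
  proof (intro conjI ballI)
    show "gamma_space G ?X (rot_action A)"
      unfolding G_def by (rule gamma_space_rot_action[OF sub act])
    show "continuous_map ?X ?Q ?\<pi>" by (rule quotient_imp_continuous_map[OF quotient_map_orbit])
    show "?\<pi> ` topspace ?X = topspace ?Q" using Q orb by auto
    show "continuous_map ?Q ?X \<phi>" by (rule cont)
    fix a assume "a \<in> topspace ?Q"
    then obtain x where x: "x \<in> A" "a = orb x" using Q by auto
    have "{y \<in> topspace ?X. ?\<pi> y = a} = orb x"
      using orb orb_eq orbA[OF x(1)] x by (auto intro: orb_refl)
    then show "{y \<in> topspace ?X. ?\<pi> y = a} \<in> orbits G (topspace ?X) (rot_action A)"
      using orb[OF x(1)] x by (auto simp: orbits_def)
    show "?\<pi> (\<phi> a) = a"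
      using \<phi>[OF x(1)] TA orb orb_eq x by auto
  qed
  then show ?thesis by blast
qed

end

context fundamental_disc_map
begin

lemma equivariant_cw_decomposition_cells:
  assumes sub: "subgroup \<Gamma> special_orthogonal_group"
  shows "equivariant_cw_decomposition (special_orthogonal_group\<lparr>carrier := \<Gamma>\<rparr>)
    (top_of_set (sphere 0 1)) (rot_action (sphere 0 1)) cells"
  unfolding equivariant_cw_decomposition_def
proof (intro conjI ballI allI impI)
  show "gamma_space (special_orthogonal_group\<lparr>carrier := \<Gamma>\<rparr>) (top_of_set (sphere 0 1)) (rot_action (sphere 0 1))"
    by (rule gamma_space_rot_action[OF sub]) auto
  show "cw_decomposition (top_of_set (sphere 0 1)) cells" by (rule cw_decomposition_cells)
  fix g n e assume g: "g \<in> carrier (special_orthogonal_group\<lparr>carrier := \<Gamma>\<rparr>)" and e: "e \<in> cells n"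
  have rot: "rot_action (sphere 0 1) g x = g *v x" if "x \<in> e" for x
    using cell_sphere[OF e] that by (auto simp: rot_action_def)
  then have im: "rot_action (sphere 0 1) g ` e = (*v) g ` e" by (rule image_cong[OF refl])
  show "rot_action (sphere 0 1) g ` e \<in> cells n" using act_cell(1)[OF _ e] g im by simp
  show "rot_action (sphere 0 1) g x = x" if "rot_action (sphere 0 1) g ` e = e" "x \<in> e" for x
    using act_cell(2)[OF _ e, of g x] g im rot that by simp
qed

end

section \<open>The orbit map as a rational function\<close>

text \<open>Projection from the north pole \<open>axis 3 1\<close>; there, division by zero yields 0
  in place of \<infinity>.\<close>

definition stereo :: "real^3 \<Rightarrow> complex"
  where "stereo x = Complex (x$1) (x$2) / (1 - x$3)"

definition stereo_inv :: "complex \<Rightarrow> real^3"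
  where "stereo_inv \<zeta> = (let d = (cmod \<zeta>)\<^sup>2 + 1 in vector [2 * Re \<zeta> / d, 2 * Im \<zeta> / d, 1 - 2 / d])"

lemma sphere3_iff: "norm (x::real^3) = 1 \<longleftrightarrow> (x$1)\<^sup>2 + (x$2)\<^sup>2 + (x$3)\<^sup>2 = 1"
  by (simp add: norm_eq_1 inner_vec_def sum_3 power2_eq_square)

lemma stereo_stereo_inv: "stereo (stereo_inv \<zeta>) = \<zeta>"
proof -
  have "(cmod \<zeta>)\<^sup>2 + 1 > 0" by (simp add: add_nonneg_pos)
  then show ?thesis
    by (simp add: stereo_def stereo_inv_def Let_def complex_eq_iff)
qed

lemma norm_stereo_inv: "norm (stereo_inv \<zeta>) = 1"
proof -
  define d where "d = (cmod \<zeta>)\<^sup>2 + 1"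
  have d: "d > 0" unfolding d_def by (simp add: add_nonneg_pos)
  have "(2 * Re \<zeta>)\<^sup>2 + (2 * Im \<zeta>)\<^sup>2 + (d - 2)\<^sup>2 = d\<^sup>2"
    unfolding d_def cmod_power2 by (simp add: power2_eq_square algebra_simps)
  then have "((2 * Re \<zeta>)\<^sup>2 + (2 * Im \<zeta>)\<^sup>2 + (d - 2)\<^sup>2) / d\<^sup>2 = 1"
    using d by simp
  moreover have "1 - 2 / d = (d - 2) / d" using d by (simp add: diff_divide_distrib)
  ultimately show ?thesis
    by (simp add: sphere3_iff stereo_inv_def Let_def d_def[symmetric]
        power_divide add_divide_distrib)
qed

lemma stereo_inv_3: "stereo_inv \<zeta> $ 3 \<noteq> 1"
proof -
  have "(cmod \<zeta>)\<^sup>2 + 1 > 0" by (simp add: add_nonneg_pos)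
  then show ?thesis
    by (simp add: stereo_inv_def Let_def)
qed

lemma norm_stereo:
  fixes x :: "real^3"
  assumes "norm x = 1" "x $ 3 \<noteq> 1"
  shows "(cmod (stereo x))\<^sup>2 + 1 = 2 / (1 - x $ 3)"
proof -
  define r where "r = 1 - x$3"
  have r: "r \<noteq> 0" "x$3 = 1 - r" using assms by (auto simp: r_def)
  have n: "(x$1)\<^sup>2 + (x$2)\<^sup>2 = 2 * r - r\<^sup>2"
    using assms(1) unfolding sphere3_iff r(2) by (simp add: power2_eq_square algebra_simps)
  have c: "stereo x = Complex (x$1 / r) (x$2 / r)"
    by (simp add: stereo_def r_def complex_eq_iff)
  have "(cmod (stereo x))\<^sup>2 = (2 * r - r\<^sup>2) / r\<^sup>2"
    unfolding n[symmetric] c by (simp add: cmod_power2 power_divide add_divide_distrib)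
  then show ?thesis
    using r by (simp add: diff_divide_distrib power2_eq_square)
qed

lemma stereo_inv_stereo:
  fixes x :: "real^3"
  assumes "norm x = 1" "x $ 3 \<noteq> 1"
  shows "stereo_inv (stereo x) = x"
  unfolding stereo_inv_def norm_stereo[OF assms] vec_eq_iff forall_3 Let_def
  using assms(2) by (simp add: stereo_def field_simps)

section \<open>Rotations as Moebius maps\<close>

text \<open>
  Both \<open>(A x)\<^sub>1 + \<i> (A x)\<^sub>2\<close> and \<open>1 - (A x)\<^sub>3\<close> are products of a factor holomorphic and a factor
  antiholomorphic in the stereographic coordinate of \<open>x\<close>. The antiholomorphic factors agree, so that
  rotations act by Moebius maps. Here \<open>s = x\<^sub>1 + \<i> x\<^sub>2\<close>, \<open>w = x\<^sub>3\<close>, \<open>(\<mu>, m)\<close> encodes the third row of \<open>A\<close>, and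
  \<open>(k, k', n)\<close> the combination of the first row with \<open>\<i>\<close> times the second one.
\<close>

lemma moebius_factorisation:
  fixes k k' n \<mu> \<mu>' m s s' w :: complex
  assumes "k * \<mu>' = n * (1 - m)" "k' * (1 - m) = - n * \<mu>'" "n * \<mu> = k * (1 + m)" "k' * \<mu> = - n * (1 + m)"
    and "s * s' = (1 - w) * (1 + w)"
  shows "(k * s' + k' * s + 2 * n * w) * ((1 - m) * s - \<mu> * (1 - w)) =
    (n * s + k * (1 - w)) * (2 - \<mu> * s' - \<mu>' * s - 2 * m * w)"
  using assms by algebra

lemma mult_eq_mult_cong: "a * b = c * d \<Longrightarrow> a = a' \<Longrightarrow> b = b' \<Longrightarrow> c = c' \<Longrightarrow> d = d' \<Longrightarrow> a' * b' = c' * (d'::'a::times)"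
  by simp

text \<open>If \<open>A $ 3 $ 3 = 1\<close>, then \<open>A\<close> fixes the north pole, all
  coefficients below vanish and the quotient degenerates to 0 / 0. Hence the assumption.\<close>

lemma rotation_stereo_moebius:
  fixes A :: "real^3^3"
  assumes A: "rotation_matrix A" and A3: "A $ 3 $ 3 \<noteq> 1"
  obtains p q :: "complex poly" where "degree p \<le> 1" "degree q \<le> 1"
    "\<And>x. norm x = 1 \<Longrightarrow> x $ 3 \<noteq> 1 \<Longrightarrow> (A *v x) $ 3 \<noteq> 1 \<Longrightarrow>
       poly q (stereo x) \<noteq> 0 \<and> stereo (A *v x) = poly p (stereo x) / poly q (stereo x)"
proof -
  define a1 a2 a3 b1 b2 b3 m1 m2 m3 where
    "a1 = A$1$1" "a2 = A$1$2" "a3 = A$1$3" "b1 = A$2$1" "b2 = A$2$2" "b3 = A$2$3"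
    "m1 = A$3$1" "m2 = A$3$2" "m3 = A$3$3"
  note d = this
  have T: "rotation_matrix (transpose A)"
    using A by (simp add: rotation_matrix_def det_transpose)
  have o: "transpose (transpose A) ** transpose A = mat 1"
    using T by (simp add: rotation_matrix_def orthogonal_matrix_def)
  have m: "m1^2 + m2^2 + m3^2 = 1"
    using arg_cong[OF o, of "\<lambda>M. M $ 3 $ 3"]
    by (simp add: matrix_matrix_mult_def transpose_def mat_def sum_3 d power2_eq_square)
  \<comment> \<open>The rows of \<open>A\<close> form a positively oriented orthonormal basis, so
    each row is the cross product of the next two in cyclic order.\<close>
  have "cross3 (transpose A *v axis 2 1) (transpose A *v axis 3 1) = transpose A *v axis 1 1"
    "cross3 (transpose A *v axis 3 1) (transpose A *v axis 1 1) = transpose A *v axis 2 1"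
    unfolding cross_rotation_matrix[OF T] cross_basis by simp_all
  then have c: "a1 = b2 * m3 - b3 * m2" "a2 = b3 * m1 - b1 * m3" "a3 = b1 * m2 - b2 * m1"
      "b1 = a3 * m2 - a2 * m3" "b2 = a1 * m3 - a3 * m1" "b3 = a2 * m1 - a1 * m2"
    by (simp_all add: vec_eq_iff forall_3 cross3_simps matrix_vector_mult_def axis_def transpose_def d sum_3)
  have o': "a1 * m1 + a2 * m2 + a3 * m3 = 0" "b1 * m1 + b2 * m2 + b3 * m3 = 0"
    using arg_cong[OF o, of "\<lambda>M. M $ 1 $ 3"] arg_cong[OF o, of "\<lambda>M. M $ 2 $ 3"]
    by (simp_all add: matrix_matrix_mult_def transpose_def mat_def sum_3 d)
  \<comment> \<open>The first four hypotheses of \<open>moebius_factorisation\<close>. With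
    \<open>s = Complex u v\<close>, the numbers \<open>Complex (a1 - b2) (b1 + a2)\<close> and
    \<open>Complex (a1 + b2) (b1 - a2)\<close> are twice the coefficients of \<open>cnj s\<close>
    and \<open>s\<close> in the first two coordinates of the image.\<close>
  have R: "Complex (a1 - b2) (b1 + a2) * Complex m1 (- m2) = Complex a3 b3 * (1 - complex_of_real m3)"
    "Complex (a1 + b2) (b1 - a2) * (1 - complex_of_real m3) = - Complex a3 b3 * Complex m1 (- m2)"
    "Complex a3 b3 * Complex m1 m2 = Complex (a1 - b2) (b1 + a2) * (1 + complex_of_real m3)"
    "Complex (a1 + b2) (b1 - a2) * Complex m1 m2 = - Complex a3 b3 * (1 + complex_of_real m3)"
    by (simp_all add: complex_eq_iff algebra_simps) (intro conjI; insert c o'; linarith)+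
  \<comment> \<open>The holomorphic factors of \<open>moebius_factorisation\<close>, divided by
    \<open>1 - w\<close>.\<close>
  define p where "p = [:Complex (a1 - b2) (b1 + a2), Complex a3 b3:]"
  define q where "q = [:- Complex m1 m2, of_real (1 - m3):]"
  show thesis
  proof
    show "degree p \<le> 1" "degree q \<le> 1" by (simp_all add: p_def q_def)
    fix x :: "real^3"
    assume x: "norm x = 1" "x $ 3 \<noteq> 1" "(A *v x) $ 3 \<noteq> 1"
    define u v w where "u = x$1" "v = x$2" "w = x$3"
    note du = this
    have n: "u^2 + v^2 + w^2 = 1" using x(1) by (simp add: sphere3_iff du)
    have w: "1 - w \<noteq> 0" using x by (simp add: du)
    define X Y Z where "X = a1 * u + a2 * v + a3 * w" "Y = b1 * u + b2 * v + b3 * w" "Z = m1 * u + m2 * v + m3 * w"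
    note dX = this
    have Ax: "(A *v x) $ 1 = X" "(A *v x) $ 2 = Y" "(A *v x) $ 3 = Z"
      by (simp_all add: matrix_vector_mult_def sum_3 d du dX)
    have Z: "1 - Z \<noteq> 0" using x Ax by simp
    have sx: "stereo x = Complex u v / (1 - w)" by (simp add: stereo_def du)
    define P where "P = Complex a3 b3 * Complex u v + Complex (a1 - b2) (b1 + a2) * (1 - w)"
    define Q where "Q = (1 - m3) * Complex u v - Complex m1 m2 * (1 - w)"
    have p: "poly p (stereo x) = P / (1 - w)" 
      using w unfolding p_def sx P_def add_divide_distrib by (simp add: mult.commute)
    have q: "poly q (stereo x) = Q / (1 - w)"
      using w unfolding q_def sx Q_def diff_divide_distrib by (simp add: mult.commute)
    \<comment> \<open>The squared modulus of \<open>Q\<close> factors into distances from height 1,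
      so \<open>Q\<close> is nonzero as long as none of the three heights \<open>m3\<close>,
      \<open>w\<close> and \<open>Z\<close> equals 1.\<close>
    have QQ: "(Re Q)^2 + (Im Q)^2 = 2 * (1 - m3) * (1 - w) * (1 - Z)"
      unfolding Q_def dX using m n by simp algebra
    then have "Q \<noteq> 0" using w Z A3 by (auto simp: d)
    moreover have "Complex X Y * Q = P * (1 - Z)"
    proof -
      have "Complex u v * Complex u (-v) = (1 - complex_of_real w) * (1 + complex_of_real w)"
        using n by (simp add: complex_eq_iff power2_eq_square algebra_simps)
      \<comment> \<open>Both sides carry a factor 2, since \<open>moebius_factorisation\<close>
        avoids halving real and imaginary parts.\<close>
      from moebius_factorisation[OF R this] have "(2 * Complex X Y) * Q = P * (2 * (1 - Z))"
        unfolding P_def Q_def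
        by (rule mult_eq_mult_cong) (simp_all add: dX complex_eq_iff algebra_simps)
      then have "2 * (Complex X Y * Q) = 2 * (P * (1 - Z))"
        by (simp only: mult.assoc mult.left_commute[of P] of_real_mult of_real_numeral)
      then show ?thesis by (metis mult_left_cancel zero_neq_numeral)
    qed
    ultimately have "Q \<noteq> 0" "Complex X Y / complex_of_real (1 - Z) = P / Q"
      using Z by (simp_all add: frac_eq_eq del: of_real_diff)
    then show "poly q (stereo x) \<noteq> 0 \<and> stereo (A *v x) = poly p (stereo x) / poly q (stereo x)"
      unfolding p q using w by (simp add: stereo_def Ax)
  qed
qed

section \<open>Behaviour at the north pole\<close>

lemma sphere3_north:
  fixes x :: "real^3"
  assumes "norm x = 1" "x $ 3 = 1"
  shows "x = axis 3 1"
  using assms by (simp add: sphere3_iff vec_eq_iff forall_3 axis_def sum_power2_eq_zero_iff)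

lemma continuous_on_stereo: "continuous_on {x. x $ 3 \<noteq> 1} stereo"
proof -
  have eq: "stereo = (\<lambda>x. (of_real (x $ 1) + \<i> * of_real (x $ 2)) / of_real (1 - x $ 3))"
    by (auto simp: stereo_def Complex_eq)
  show ?thesis
    unfolding eq by (intro continuous_intros; auto simp del: of_real_diff)
qed

lemma continuous_on_stereo_inv: "continuous_on A stereo_inv"
proof -
  have "(cmod \<zeta>)\<^sup>2 + 1 \<noteq> 0" for \<zeta> by (metis add_nonneg_pos less_irrefl zero_le_power2 zero_less_one)
  then show ?thesis
    unfolding continuous_on_componentwise[where 'b="real^3"] Basis_vec_def
    by (auto simp: inner_axis stereo_inv_def Let_def UNIV_3 intro!: continuous_intros)
qed

lemma filterlim_stereo: "filterlim stereo at_infinity (at (axis 3 1) within (sphere 0 1 - {axis 3 1}))"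
  unfolding filterlim_at_infinity_conv_norm_at_top filterlim_at_top
proof
  fix Z :: real
  let ?F = "at (axis 3 1 :: real^3) within (sphere 0 1 - {axis 3 1})"
  have "((\<lambda>x::real^3. x $ 3) \<longlongrightarrow> (axis 3 1 :: real^3) $ 3) ?F" by (intro tendsto_intros)
  then have "((\<lambda>x::real^3. x $ 3) \<longlongrightarrow> 1) ?F" by simp
  \<comment> \<open>By \<open>norm_stereo\<close>, this is the height above which the squared
    modulus of the projection exceeds \<open>Z\<close> squared.\<close>
  then have "\<forall>\<^sub>F x in ?F. x $ 3 > 1 - 2 / (Z\<^sup>2 + 1)"
    by (rule order_tendstoD) (auto simp: add_nonneg_pos)
  moreover have "\<forall>\<^sub>F x in ?F. x \<in> sphere 0 1 - {axis 3 1}"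
    by (simp add: eventually_at_filter)
  ultimately show "\<forall>\<^sub>F x in ?F. Z \<le> norm (stereo x)"
  proof eventually_elim
    case (elim x)
    then have x: "norm x = 1" "x $ 3 \<noteq> 1" using sphere3_north by auto
    moreover have "x $ 3 \<le> 1" using component_le_norm_cart[of x 3] x by linarith
    ultimately have p: "1 - x $ 3 > 0" by linarith
    have q: "Z\<^sup>2 + 1 > 0" by (simp add: add_nonneg_pos)
    have "1 - x $ 3 < 2 / (Z\<^sup>2 + 1)" using elim by linarith
    then have "Z\<^sup>2 + 1 < 2 / (1 - x $ 3)" using p q by (simp add: field_simps)
    then have "Z\<^sup>2 < (cmod (stereo x))\<^sup>2" using norm_stereo[OF x] by linarith
    then show ?case by (meson norm_ge_zero power2_less_imp_less order_less_imp_le)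
  qed
qed

section \<open>The invariant map and its poles\<close>

text \<open>The rotation \<open>R\<close> carries \<open>b\<close> to the north pole, so that
  \<open>stereo\<close> after \<open>R\<close> is the projection from \<open>b\<close>.\<close>

locale rotation_group_regular_point = finite_rotation_group +
  fixes b :: "real^3" and R :: "real^3^3"
  assumes b: "norm b = 1" "b \<notin> singular_points"
    and R: "rotation_matrix R" "R *v b = axis 3 1"
begin

abbreviation "punctured_sphere \<equiv> sphere 0 1 - orb b"

definition invariant_map :: "real^3 \<Rightarrow> complex"
  where "invariant_map x = (\<Sum>g\<in>\<Gamma>. stereo (R *v (g *v x)))"

lemma R_orth: "transpose R ** R = mat 1" "R ** transpose R = mat 1"
  using R(1) by (auto simp: rotation_matrix_def orthogonal_matrix_def)

lemma R_inv [simp]: "transpose R *v (R *v x) = x" "R *v (transpose R *v x) = x"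
  by (simp_all add: matrix_vector_mul_assoc R_orth)

lemma R_norm [simp]: "norm (R *v x) = norm x" "norm (transpose R *v x) = norm x"
proof -
  show *: "norm (R *v x) = norm x" for x
    using R(1) orthogonal_transformation_matrix[of "(*v) R"]
    by (auto simp: rotation_matrix_def intro!: orthogonal_transformation_norm)
  show "norm (transpose R *v x) = norm x"
    using *[of "transpose R *v x"] by simp
qed

lemma R_north: "norm x = 1 \<Longrightarrow> (R *v x) $ 3 = 1 \<longleftrightarrow> x = b"
  using R(2) sphere3_north[of "R *v x"] by (metis R_inv(1) R_norm(1) axis_nth)

lemma act_eq_b: "g \<in> \<Gamma> \<Longrightarrow> g *v x = b \<Longrightarrow> x \<in> orb b"
  using orb_sym orbI by blast

lemma b_sphere: "b \<in> sphere 0 1" using b by simp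

lemma punctured_act: "g \<in> \<Gamma> \<Longrightarrow> g *v x \<in> punctured_sphere \<longleftrightarrow> x \<in> punctured_sphere"
  by (auto simp: orb_act)

lemma punctured_ne_b: "g \<in> \<Gamma> \<Longrightarrow> x \<in> punctured_sphere \<Longrightarrow> (R *v (g *v x)) $ 3 \<noteq> 1"
  using R_north[of "g *v x"] act_eq_b by auto

lemma continuous_on_invariant_map: "continuous_on punctured_sphere invariant_map"
  unfolding invariant_map_def
  by (intro continuous_on_sum continuous_on_compose2[OF continuous_on_stereo] continuous_intros)
     (use punctured_ne_b in auto)

lemma invariant_map_act:
  assumes "h \<in> \<Gamma>"
  shows "invariant_map (h *v x) = invariant_map x"
proof -
  have *: "g ** h ** transpose h = g" "g ** transpose h ** h = g" for g
    using assms by (metis matrix_mul_assoc matrix_mul_rid transpose_mult)+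
  show ?thesis
    unfolding invariant_map_def matrix_vector_mul_assoc[of _ h]
    by (rule sum.reindex_bij_witness[of _ "\<lambda>g. g ** transpose h" "\<lambda>g. g ** h"])
       (simp_all add: * assms mult inv)
qed

text \<open>As \<open>b\<close> has trivial stabiliser, exactly one element \<open>g0\<close> moves
  \<open>x\<close> to \<open>b\<close>. Its summand blows up while the others converge, so no poles
  cancel.\<close>

lemma filterlim_invariant_map:
  assumes x: "x \<in> orb b"
  shows "filterlim invariant_map at_infinity (at x within punctured_sphere)"
proof -
  obtain g0 where g0: "g0 \<in> \<Gamma>" "g0 *v x = b"
    using orb_sym[OF x] by (auto simp: orb_def)
  have nx: "norm x = 1" using g0 b norm_act by metis
  let ?F = "at x within punctured_sphere"
  have ne: "g *v x \<noteq> b" if "g \<in> \<Gamma> - {g0}" for g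
  proof
    assume "g *v x = b"
    then have "(g ** transpose g0) *v b = b"
      using g0 by (metis matrix_vector_mul_assoc transpose_mult_vec(1))
    then have "g ** transpose g0 = mat 1"
      using that g0 b mult inv by (auto simp: singular_points_def)
    then have "g ** (transpose g0 ** g0) = g0" by (simp add: matrix_mul_assoc)
    then show False using that g0 by (simp add: transpose_mult)
  qed
  have "((\<lambda>y. \<Sum>g\<in>\<Gamma>-{g0}. stereo (R *v (g *v y))) \<longlongrightarrow> (\<Sum>g\<in>\<Gamma>-{g0}. stereo (R *v (g *v x)))) ?F"
  proof (intro tendsto_sum)
    fix g assume g: "g \<in> \<Gamma> - {g0}"
    have "continuous_on (insert x punctured_sphere) (\<lambda>y. stereo (R *v (g *v y)))"
      by (intro continuous_on_compose2[OF continuous_on_stereo] continuous_intros)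
        (use punctured_ne_b g ne[OF g] R_north[of "g *v x"] nx in auto)
    then show "((\<lambda>y. stereo (R *v (g *v y))) \<longlongrightarrow> stereo (R *v (g *v x))) ?F"
      by (auto simp: continuous_on_def intro: tendsto_within_subset)
  qed
  moreover have "filterlim (\<lambda>y. stereo (R *v (g0 *v y))) at_infinity ?F"
  proof (rule filterlim_compose[OF filterlim_stereo])
    have "((\<lambda>y. R *v (g0 *v y)) \<longlongrightarrow> R *v (g0 *v x)) ?F"
      by (intro tendsto_intros bounded_linear.tendsto[OF matrix_vector_mul_bounded_linear])
    moreover have "\<forall>\<^sub>F y in ?F. R *v (g0 *v y) \<in> sphere 0 1 - {axis 3 1}"
    proof -
      have "R *v (g0 *v y) \<in> sphere 0 1 - {axis 3 1}" if "y \<in> punctured_sphere" for y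
        using that punctured_ne_b[OF g0(1) that] g0 by auto
      then show ?thesis by (auto simp: eventually_at_filter)
    qed
    ultimately show "filterlim (\<lambda>y. R *v (g0 *v y)) (at (axis 3 1) within sphere 0 1 - {axis 3 1}) ?F"
      using g0 R by (auto simp: filterlim_at elim: eventually_mono)
  qed
  ultimately have "filterlim (\<lambda>y. (\<Sum>g\<in>\<Gamma>-{g0}. stereo (R *v (g *v y))) + stereo (R *v (g0 *v y))) at_infinity ?F"
    by (rule tendsto_add_filterlim_at_infinity)
  moreover have "invariant_map = (\<lambda>y. (\<Sum>g\<in>\<Gamma>-{g0}. stereo (R *v (g *v y))) + stereo (R *v (g0 *v y)))"
    using g0 fin by (auto simp: invariant_map_def sum.remove[of \<Gamma> g0])
  ultimately show ?thesis by simp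
qed

text \<open>Properness: a limit point of the set cannot lie in \<open>orb b\<close>, where the
  invariant map is unbounded. This replaces compactness of the sphere once that orbit is
  removed.\<close>

lemma compact_invariant_map_bounded:
  "compact {x \<in> punctured_sphere. norm (invariant_map x) \<le> r}" (is "compact ?K")
proof -
  have "closed ?K"
    unfolding closed_limpt
  proof (intro allI impI)
    fix x assume x: "x islimpt ?K"
    have xS: "norm x = 1"
    proof -
      have "x islimpt sphere 0 1" by (rule islimpt_subset[OF x]) auto
      then have "x \<in> sphere 0 1" using closed_limpt closed_sphere by blast
      then show ?thesis by simp
    qed
    have nt: "at x within ?K \<noteq> bot"
      using x by (simp add: trivial_limit_within)
    have bd: "\<forall>\<^sub>F y in at x within ?K. norm (invariant_map y) \<le> r"
      by (simp add: eventually_at_filter)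
    have sub: "at x within ?K \<le> at x within punctured_sphere"
      by (rule at_le) auto
    show "x \<in> ?K"
    proof (cases "x \<in> orb b")
      case True
      have "\<forall>\<^sub>F y in at x within punctured_sphere. norm (invariant_map y) \<ge> r + 1"
        using filterlim_invariant_map[OF True]
        by (auto simp: filterlim_at_infinity_conv_norm_at_top filterlim_at_top)
      then have "\<forall>\<^sub>F y in at x within ?K. norm (invariant_map y) \<ge> r + 1"
        using sub by (auto simp: le_filter_def)
      with bd have "\<forall>\<^sub>F y in at x within ?K. False"
        by eventually_elim simp
      with nt show ?thesis by (simp add: trivial_limit_def)
    next
      case False
      then have "x \<in> punctured_sphere" using xS by simp
      moreover from this have "(invariant_map \<longlongrightarrow> invariant_map x) (at x within ?K)"
        using continuous_on_invariant_map sub by (auto simp: continuous_on_def intro: tendsto_mono)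
      then have "norm (invariant_map x) \<le> r"
        using bd nt by (intro tendsto_upperbound[of "\<lambda>y. norm (invariant_map y)"]) (auto intro: tendsto_norm)
      ultimately show ?thesis by simp
    qed
  qed
  moreover have "bounded ?K"
    by (rule bounded_subset[OF bounded_sphere[of 0 1]]) auto
  ultimately show ?thesis by (simp add: compact_eq_bounded_closed)
qed

section \<open>Degree, openness and fibres of the invariant map\<close>

definition chart :: "complex \<Rightarrow> real^3"
  where "chart \<zeta> = transpose R *v stereo_inv \<zeta>"

text \<open>The point \<open>b\<close> lies over \<open>\<infinity>\<close>; it is left out because of the junk value \<open>stereo (R *v b) = 0 / 0 = 0\<close>.\<close>

definition poles :: "complex set"
  where "poles = (\<lambda>x. stereo (R *v x)) ` (orb b - {b})"

lemma finite_poles: "finite poles"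
  by (simp add: poles_def)

lemma norm_chart [simp]: "norm (chart \<zeta>) = 1"
  by (simp add: chart_def norm_stereo_inv)

lemma chart_stereo: "x \<in> sphere 0 1 \<Longrightarrow> x \<noteq> b \<Longrightarrow> chart (stereo (R *v x)) = x"
  using R_north[of x] by (simp add: chart_def stereo_inv_stereo)

lemma stereo_chart [simp]: "stereo (R *v chart \<zeta>) = \<zeta>"
  by (simp add: chart_def stereo_stereo_inv)

lemma chart_punctured:
  assumes "\<zeta> \<notin> poles"
  shows "chart \<zeta> \<in> punctured_sphere"
proof -
  have "chart \<zeta> \<noteq> b"
    using R_north[of "chart \<zeta>"] stereo_inv_3[of \<zeta>] by (simp add: chart_def norm_stereo_inv)
  then have "chart \<zeta> \<notin> orb b"
    using assms stereo_chart[of \<zeta>] unfolding poles_def by (metis Diff_iff imageI singletonD)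
  then show ?thesis by simp
qed

lemma punctured_stereo:
  assumes "x \<in> punctured_sphere"
  shows "stereo (R *v x) \<notin> poles" "chart (stereo (R *v x)) = x"
proof -
  have "x \<noteq> b" using assms by auto
  then show c: "chart (stereo (R *v x)) = x" using assms by (simp add: chart_stereo)
  show "stereo (R *v x) \<notin> poles"
  proof
    assume "stereo (R *v x) \<in> poles"
    then obtain y where "y \<in> orb b" "y \<noteq> b" "stereo (R *v x) = stereo (R *v y)"
      by (auto simp: poles_def)
    then show False using c chart_stereo[of y] orb_subset_sphere[OF b_sphere] assms by auto
  qed
qed


lemma punctured_sphere_limit: "b islimpt punctured_sphere"
proof -
  have "b islimpt sphere 0 1"
  proof (rule connected_imp_perfect)
    show "connected (sphere (0::real^3) 1)" by (rule connected_sphere) simp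
    show "sphere (0::real^3) 1 \<noteq> {a}" for a
      using infinite_sphere3 by (metis finite.emptyI finite_insert)
  qed (rule b_sphere)
  moreover have "sphere 0 1 = orb b \<union> punctured_sphere"
    using orb_subset_sphere[OF b_sphere] by blast
  ultimately show ?thesis
    using islimpt_Un_finite[OF finite_orb] by metis
qed

lemma invariant_map_unbounded:
  obtains x where "x \<in> punctured_sphere" "norm (invariant_map x) > r"
proof -
  have "at b within punctured_sphere \<noteq> bot"
    using punctured_sphere_limit by (simp add: trivial_limit_within)
  moreover have "\<forall>\<^sub>F y in at b within punctured_sphere. norm (invariant_map y) > r"
    using filterlim_invariant_map[OF orb_refl]
    by (auto simp: filterlim_at_infinity_conv_norm_at_top filterlim_at_top_dense)
  moreover have "\<forall>\<^sub>F y in at b within punctured_sphere. y \<in> punctured_sphere"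
    by (simp add: eventually_at_filter)
  ultimately have "\<exists>y. norm (invariant_map y) > r \<and> y \<in> punctured_sphere"
    by (intro eventually_happens'[of "at b within punctured_sphere"] eventually_conj)
  then show ?thesis using that by blast
qed

text \<open>In the chart, \<open>g\<close> becomes its conjugate by \<open>R\<close>. The corner
  entry 1 would mean that \<open>g\<close> fixes \<open>b\<close>, which regularity of
  \<open>b\<close> allows only for the identity.\<close>

lemma act_moebius:
  assumes "g \<in> \<Gamma>" "g \<noteq> mat 1"
  shows "\<exists>p q. degree p \<le> 1 \<and> degree q \<le> 1 \<and> (\<forall>\<zeta>. \<zeta> \<notin> poles \<longrightarrow>
    poly q \<zeta> \<noteq> 0 \<and> stereo (R *v (g *v chart \<zeta>)) = poly p \<zeta> / poly q \<zeta>)"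
proof -
  let ?A = "R ** g ** transpose R"
  have A: "?A *v y = R *v (g *v (transpose R *v y))" for y
    by (simp only: matrix_vector_mul_assoc matrix_mul_assoc)
  have "rotation_matrix ?A"
    using R(1) rot[OF assms(1)]
    by (auto simp: rotation_matrix_def orthogonal_matrix_mul det_mul det_transpose)
  moreover have "?A $ 3 $ 3 \<noteq> 1"
  proof
    assume "?A $ 3 $ 3 = 1"
    then have "(?A *v axis 3 1) $ 3 = 1"
      by (simp add: matrix_vector_mult_basis column_def)
    then have "(R *v (g *v b)) $ 3 = 1"
      unfolding A by (metis R(2) R_inv(1))
    then have "g *v b = b" using R_north[of "g *v b"] assms b by simp
    then show False using b assms by (auto simp: singular_points_def)
  qed
  ultimately obtain p q :: "complex poly" where pq: "degree p \<le> 1" "degree q \<le> 1"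
    "\<And>x. norm x = 1 \<Longrightarrow> x $ 3 \<noteq> 1 \<Longrightarrow> (?A *v x) $ 3 \<noteq> 1 \<Longrightarrow>
       poly q (stereo x) \<noteq> 0 \<and> stereo (?A *v x) = poly p (stereo x) / poly q (stereo x)"
    using rotation_stereo_moebius by blast
  show ?thesis
  proof (intro exI conjI allI impI)
    fix \<zeta> assume "\<zeta> \<notin> poles"
    then have "(?A *v (R *v chart \<zeta>)) $ 3 \<noteq> 1"
      unfolding A using punctured_ne_b[OF assms(1) chart_punctured] by simp
    then have "(?A *v stereo_inv \<zeta>) $ 3 \<noteq> 1" by (simp add: chart_def)
    from pq(3)[OF norm_stereo_inv stereo_inv_3 this]
    have "poly q \<zeta> \<noteq> 0 \<and> stereo (R *v (g *v chart \<zeta>)) = poly p \<zeta> / poly q \<zeta>"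
      unfolding A stereo_stereo_inv by (simp add: chart_def)
    then show "poly q \<zeta> \<noteq> 0" "stereo (R *v (g *v chart \<zeta>)) = poly p \<zeta> / poly q \<zeta>"
      by auto
  qed (use pq in auto)
qed

text \<open>The identity contributes \<zeta> itself, and every other element a quotient of
  polynomials of degree at most 1. A common denominator thus has \<open>card \<Gamma> - 1\<close>
  such factors, and the summand \<zeta> raises the bound for the numerator by one.\<close>

lemma invariant_map_rational:
  "\<exists>p q. degree p \<le> card \<Gamma> \<and> degree q < card \<Gamma> \<and> (\<forall>\<zeta>. \<zeta> \<notin> poles \<longrightarrow>
    poly q \<zeta> \<noteq> 0 \<and> invariant_map (chart \<zeta>) = poly p \<zeta> / poly q \<zeta>)"
proof -
  define \<Phi> where "\<Phi> g P Q \<longleftrightarrow> degree P \<le> 1 \<and> degree Q \<le> 1 \<and> (\<forall>\<zeta>. \<zeta> \<notin> poles \<longrightarrow>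
      poly Q \<zeta> \<noteq> 0 \<and> stereo (R *v (g *v chart \<zeta>)) = poly P \<zeta> / poly Q \<zeta>)" for g P Q
  have "\<exists>P Q. \<Phi> g P Q" if "g \<in> \<Gamma> - {mat 1}" for g
    unfolding \<Phi>_def using that by (intro act_moebius) auto
  then obtain P Q where \<Phi>: "\<And>g. g \<in> \<Gamma> - {mat 1} \<Longrightarrow> \<Phi> g (P g) (Q g)"
    by metis
  have PQ: "\<And>g. g \<in> \<Gamma> - {mat 1} \<Longrightarrow> degree (P g) \<le> 1" "\<And>g. g \<in> \<Gamma> - {mat 1} \<Longrightarrow> degree (Q g) \<le> 1"
      "\<And>g \<zeta>. g \<in> \<Gamma> - {mat 1} \<Longrightarrow> \<zeta> \<notin> poles \<Longrightarrow> poly (Q g) \<zeta> \<noteq> 0"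
      "\<And>g \<zeta>. g \<in> \<Gamma> - {mat 1} \<Longrightarrow> \<zeta> \<notin> poles \<Longrightarrow> stereo (R *v (g *v chart \<zeta>)) = poly (P g) \<zeta> / poly (Q g) \<zeta>"
    using \<Phi> unfolding \<Phi>_def by blast+
  define \<Gamma>' where "\<Gamma>' = \<Gamma> - {mat 1}"
  have f': "finite \<Gamma>'" using fin by (simp add: \<Gamma>'_def)
  have c: "card \<Gamma> = Suc (card \<Gamma>')" using card_Suc_Diff1[OF fin one] by (simp add: \<Gamma>'_def)
  have dQ: "degree (\<Prod>g\<in>B. Q g) \<le> card B" if "B \<subseteq> \<Gamma>'" for B
  proof -
    have "degree (\<Prod>g\<in>B. Q g) \<le> (\<Sum>g\<in>B. degree (Q g))"
      using degree_prod_sum_le[of B Q] finite_subset[OF that f'] by (simp add: o_def)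
    also have "\<dots> \<le> (\<Sum>g\<in>B. 1)" using PQ(2) that by (intro sum_mono) (auto simp: \<Gamma>'_def)
    finally show ?thesis by simp
  qed
  define q where "q = (\<Prod>g\<in>\<Gamma>'. Q g)"
  define p where "p = [:0, 1:] * q + (\<Sum>g\<in>\<Gamma>'. P g * (\<Prod>h\<in>\<Gamma>'-{g}. Q h))"
  show ?thesis
  proof (intro exI conjI allI impI)
    show "degree q < card \<Gamma>" using dQ[of \<Gamma>'] by (simp add: q_def c)
    have "degree ([:0, 1:] * q) \<le> card \<Gamma>"
      using degree_mult_le[of "[:0,1:]" q] dQ[of \<Gamma>'] by (simp add: q_def c)
    moreover have "degree (P g * (\<Prod>h\<in>\<Gamma>'-{g}. Q h)) \<le> card \<Gamma>" if "g \<in> \<Gamma>'" for g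
      using degree_mult_le[of "P g" "\<Prod>h\<in>\<Gamma>'-{g}. Q h"] dQ[of "\<Gamma>'-{g}"] PQ(1)[of g] that
        card_Diff1_le[of \<Gamma>' g]
      by (simp add: c \<Gamma>'_def)
    ultimately show "degree p \<le> card \<Gamma>"
      unfolding p_def by (intro degree_add_le degree_sum_le f')
    fix \<zeta> assume z: "\<zeta> \<notin> poles"
    have q: "poly q \<zeta> \<noteq> 0"
      using f' PQ(3) z by (auto simp: q_def poly_prod \<Gamma>'_def)
    have "invariant_map (chart \<zeta>) = stereo (R *v (mat 1 *v chart \<zeta>)) + (\<Sum>g\<in>\<Gamma>'. stereo (R *v (g *v chart \<zeta>)))"
      unfolding invariant_map_def \<Gamma>'_def by (rule sum.remove) (use fin one in auto)
    also have "\<dots> = \<zeta> + (\<Sum>g\<in>\<Gamma>'. poly (P g) \<zeta> / poly (Q g) \<zeta>)"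
      using PQ(4) z by (simp add: \<Gamma>'_def)
    also have "(\<Sum>g\<in>\<Gamma>'. poly (P g) \<zeta> / poly (Q g) \<zeta>) =
        (\<Sum>g\<in>\<Gamma>'. poly (P g) \<zeta> * (\<Prod>h\<in>\<Gamma>'-{g}. poly (Q h) \<zeta>) / poly q \<zeta>)"
    proof (rule sum.cong)
      fix g assume g: "g \<in> \<Gamma>'"
      have "poly q \<zeta> = poly (Q g) \<zeta> * (\<Prod>h\<in>\<Gamma>'-{g}. poly (Q h) \<zeta>)"
        unfolding q_def poly_prod by (rule prod.remove[OF f' g])
      then show "poly (P g) \<zeta> / poly (Q g) \<zeta> = poly (P g) \<zeta> * (\<Prod>h\<in>\<Gamma>'-{g}. poly (Q h) \<zeta>) / poly q \<zeta>"
        using q by simp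
    qed simp
    also have "\<zeta> + \<dots> = poly p \<zeta> / poly q \<zeta>"
      using q by (simp add: p_def poly_sum poly_prod add_divide_distrib sum_divide_distrib)
    finally show "invariant_map (chart \<zeta>) = poly p \<zeta> / poly q \<zeta>" .
    show "poly q \<zeta> \<noteq> 0" by (rule q)
  qed
qed

text \<open>In the chart, the fibre over \<open>w\<close> consists of roots of
  \<open>p - smult w q\<close>. This polynomial is nonzero, for otherwise the invariant map would be
  constant, although it is unbounded.\<close>

lemma card_invariant_map_fibre:
  "finite {x \<in> punctured_sphere. invariant_map x = w} \<and> card {x \<in> punctured_sphere. invariant_map x = w} \<le> card \<Gamma>"
proof -
  obtain p q :: "complex poly" where pq: "degree p \<le> card \<Gamma>" "degree q < card \<Gamma>"
    "\<And>\<zeta>. \<zeta> \<notin> poles \<Longrightarrow> poly q \<zeta> \<noteq> 0 \<and> invariant_map (chart \<zeta>) = poly p \<zeta> / poly q \<zeta>"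
    using invariant_map_rational by blast
  define W where "W = p - smult w q"
  have W: "poly W \<zeta> = 0 \<longleftrightarrow> invariant_map (chart \<zeta>) = w" if "\<zeta> \<notin> poles" for \<zeta>
    using pq(3)[OF that] by (auto simp: W_def field_simps)
  have "W \<noteq> 0"
  proof
    assume "W = 0"
    moreover obtain x where x: "x \<in> punctured_sphere" "norm (invariant_map x) > norm w"
      by (rule invariant_map_unbounded)
    ultimately show False
      using W[OF punctured_stereo(1)[OF x(1)]] punctured_stereo(2)[OF x(1)] by simp
  qed
  moreover have "degree W \<le> card \<Gamma>"
    unfolding W_def using pq(1,2) degree_smult_le[of w q] by (intro degree_diff_le) auto
  ultimately have roots: "finite {\<zeta>. poly W \<zeta> = 0}" "card {\<zeta>. poly W \<zeta> = 0} \<le> card \<Gamma>"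
    using poly_roots_finite[of W] card_poly_roots_bound[of W] by auto
  have "{x \<in> punctured_sphere. invariant_map x = w} \<subseteq> chart ` {\<zeta>. poly W \<zeta> = 0}"
  proof
    fix x assume x: "x \<in> {x \<in> punctured_sphere. invariant_map x = w}"
    then have "x \<in> punctured_sphere" by simp
    note s = punctured_stereo[OF this]
    show "x \<in> chart ` {\<zeta>. poly W \<zeta> = 0}"
      using W[OF s(1)] s(2) x by (intro image_eqI[of _ _ "stereo (R *v x)"]) auto
  qed
  with roots show ?thesis
    by (meson card_image_le card_mono finite_imageI finite_subset le_trans)
qed

text \<open>The chart identifies the punctured sphere with the plane minus finitely many points,
  where the invariant map is holomorphic and not constant.\<close>

lemma open_invariant_map:
  assumes "open V"
  shows "open (invariant_map ` (punctured_sphere \<inter> V))"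
proof -
  obtain p q :: "complex poly" where pq: 
    "\<And>\<zeta>. \<zeta> \<notin> poles \<Longrightarrow> poly q \<zeta> \<noteq> 0 \<and> invariant_map (chart \<zeta>) = poly p \<zeta> / poly q \<zeta>"
    using invariant_map_rational by blast
  have eq: "invariant_map ` (punctured_sphere \<inter> V) = (\<lambda>\<zeta>. invariant_map (chart \<zeta>)) ` (- poles \<inter> chart -` V)"
  proof -
    have "punctured_sphere \<inter> V = chart ` (- poles \<inter> chart -` V)"
    proof
      show "punctured_sphere \<inter> V \<subseteq> chart ` (- poles \<inter> chart -` V)"
      proof
        fix x assume x: "x \<in> punctured_sphere \<inter> V"
        then have "x \<in> punctured_sphere" by blast
        from punctured_stereo[OF this] x show "x \<in> chart ` (- poles \<inter> chart -` V)"
          by (intro image_eqI[of _ _ "stereo (R *v x)"]) auto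
      qed
      show "chart ` (- poles \<inter> chart -` V) \<subseteq> punctured_sphere \<inter> V"
        using chart_punctured by auto
    qed
    then show ?thesis by (simp only: image_image)
  qed
  show ?thesis
    unfolding eq
  proof (rule open_mapping_thm)
    have "(\<lambda>\<zeta>. poly p \<zeta> / poly q \<zeta>) holomorphic_on (- poles)"
      using pq by (auto intro!: holomorphic_intros)
    then show "(\<lambda>\<zeta>. invariant_map (chart \<zeta>)) holomorphic_on (- poles)"
      using pq by (auto intro: holomorphic_transform)
    show "open (- poles)" using finite_poles by (simp add: finite_imp_closed open_Compl)
    moreover have "continuous_on UNIV chart"
      unfolding chart_def by (intro continuous_intros continuous_on_stereo_inv)
    ultimately show "open (- poles \<inter> chart -` V)"
      using assms by (auto intro: open_vimage)
    show "connected (- poles)"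
      using connected_open_delete_finite[of UNIV poles] finite_poles connected_UNIV by (simp add: Compl_eq_Diff_UNIV)
    show "\<not> (\<lambda>\<zeta>. invariant_map (chart \<zeta>)) constant_on - poles"
    proof
      assume "(\<lambda>\<zeta>. invariant_map (chart \<zeta>)) constant_on - poles"
      then obtain c where c: "\<And>\<zeta>. \<zeta> \<notin> poles \<Longrightarrow> invariant_map (chart \<zeta>) = c"
        by (auto simp: constant_on_def)
      obtain x where x: "x \<in> punctured_sphere" "norm (invariant_map x) > norm c"
        by (rule invariant_map_unbounded)
      show False using c[OF punctured_stereo(1)[OF x(1)]] punctured_stereo(2)[OF x(1)] x(2) by simp
    qed
  qed auto
qed

text \<open>The image is open by the open mapping theorem and closed by properness, and the plane is
  connected.\<close>

lemma invariant_map_surj: "invariant_map ` punctured_sphere = UNIV"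
proof -
  let ?I = "invariant_map ` punctured_sphere"
  have "open ?I" using open_invariant_map[of UNIV] by simp
  moreover have "closed ?I"
    unfolding closed_sequential_limits
  proof (intro allI impI)
    fix y l assume yl: "(\<forall>n. y n \<in> ?I) \<and> y \<longlonglongrightarrow> l"
    then obtain r where r: "\<And>n. norm (y n) \<le> r"
      using Bseq_def convergent_imp_Bseq convergentI by (metis)
    let ?K = "{x \<in> punctured_sphere. norm (invariant_map x) \<le> r}"
    have "closed (invariant_map ` ?K)"
      by (intro compact_imp_closed compact_continuous_image compact_invariant_map_bounded
          continuous_on_subset[OF continuous_on_invariant_map]) auto
    moreover have "y n \<in> invariant_map ` ?K" for n
    proof -
      obtain x where "x \<in> punctured_sphere" "y n = invariant_map x" using yl by blast
      then show ?thesis using r[of n] by (intro image_eqI[of _ _ x]) auto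
    qed
    ultimately have "l \<in> invariant_map ` ?K"
      using yl closed_sequentially[of "invariant_map ` ?K" y l] by blast
    then show "l \<in> ?I" by auto
  qed
  moreover have "?I \<noteq> {}"
    using invariant_map_unbounded[of 0] by blast
  ultimately show ?thesis by (metis clopen)
qed

text \<open>
  Since \<open>invariant_map\<close> is open, two orbits in one fibre would yield two regular orbits in a nearby
  fibre, which has at most \<open>|\<Gamma>|\<close> points.
\<close>

lemma invariant_map_eq_imp_orb:
  assumes x: "x \<in> punctured_sphere" and y: "y \<in> punctured_sphere" and eq: "invariant_map x = invariant_map y"
  shows "y \<in> orb x"
proof (rule ccontr)
  assume "y \<notin> orb x"
  then obtain V W where VW: "open V" "open W" "x \<in> V" "y \<in> W" "\<And>v w. v \<in> V \<Longrightarrow> w \<in> W \<Longrightarrow> w \<notin> orb v"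
    using separating_neighbourhoods by blast
  let ?U = "invariant_map ` (punctured_sphere \<inter> V) \<inter> invariant_map ` (punctured_sphere \<inter> W)"
  have "open ?U" using VW by (intro open_Int open_invariant_map)
  moreover have "invariant_map x \<in> ?U"
    using x y VW(3,4) eq by (metis IntI imageI)
  ultimately have "infinite ?U" using finite_imp_not_open by blast
  moreover have "finite (invariant_map ` singular_points)" using finite_singular_points by simp
  ultimately obtain c where c: "c \<in> ?U" "c \<notin> invariant_map ` singular_points"
    by (meson finite_subset subsetI)
  then obtain v w where vw: "v \<in> punctured_sphere" "v \<in> V" "invariant_map v = c"
      "w \<in> punctured_sphere" "w \<in> W" "invariant_map w = c" by auto
  have sub: "orb v \<union> orb w \<subseteq> {x \<in> punctured_sphere. invariant_map x = c}"
  proof -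
    have "y \<in> {x \<in> punctured_sphere. invariant_map x = c}"
      if "y \<in> orb u" "u \<in> punctured_sphere" "invariant_map u = c" for u y
    proof -
      obtain g where "g \<in> \<Gamma>" "y = g *v u" using \<open>y \<in> orb u\<close> by (auto simp: orb_def)
      then show ?thesis using that invariant_map_act punctured_act by blast
    qed
    then show ?thesis using vw by blast
  qed
  have "orb v \<inter> orb w = {}"
    using VW(5)[OF vw(2,5)] orb_sym orb_trans by blast
  then have "card (orb v \<union> orb w) = card (orb v) + card (orb w)"
    by (intro card_Un_disjoint) auto
  moreover have "card (orb v) = card \<Gamma>" "card (orb w) = card \<Gamma>"
    using vw c(2) by (metis DiffD1 card_orb_regular imageI)+
  moreover have "card (orb v \<union> orb w) \<le> card \<Gamma>"
    using card_mono[OF _ sub] card_invariant_map_fibre[of c] by auto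
  moreover have "card \<Gamma> > 0" using one fin by (auto simp: card_gt_0_iff)
  ultimately show False by simp
qed

end

section \<open>Lifting a folded disc through the orbit map\<close>

text \<open>The Cayley map takes the disc to the right half-plane and the circle to the imaginary
  axis, which squaring folds onto the negative axis. At \<open>u = 1\<close> division by zero gives
  0 instead of \<infinity>, which is also the value at -1; hence the separate treatment of
  \<open>u = 1\<close> throughout.\<close>

definition disc_fold :: "complex \<Rightarrow> complex"
  where "disc_fold u = ((1 + u) / (1 - u))\<^sup>2"

lemma cayley_inj:
  fixes u v :: complex
  assumes "u \<noteq> 1" "v \<noteq> 1" "(1 + u) / (1 - u) = (1 + v) / (1 - v)"
  shows "u = v"
proof -
  have "(1 + u) * (1 - v) = (1 + v) * (1 - u)"
    using assms by (simp add: frac_eq_eq)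
  then have "2 * u = 2 * v" by algebra
  then show ?thesis by simp
qed

lemma Re_cayley: "Re ((1 + u) / (1 - u)) = (1 - (cmod u)\<^sup>2) / (cmod (1 - u))\<^sup>2"
  unfolding Re_divide cmod_power2
  by (simp add: power2_eq_square algebra_simps)

text \<open>On the circle \<open>cnj u\<close> is the inverse of \<open>u\<close>, and inversion
  changes the sign of the Cayley map.\<close>

lemma cayley_cnj:
  assumes "cmod u = 1" "u \<noteq> 1"
  shows "(1 + cnj u) / (1 - cnj u) = - ((1 + u) / (1 - u))"
proof -
  have "u * cnj u = 1" using assms by (simp add: complex_norm_square[symmetric])
  moreover have "cnj u \<noteq> 1" using assms by (metis complex_cnj_cnj complex_cnj_one)
  moreover have "(1 + cnj u) * (1 - u) = - (1 + u) * (1 - cnj u)"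
    using \<open>u * cnj u = 1\<close> by algebra
  ultimately show ?thesis
    unfolding minus_divide_left using assms by (subst frac_eq_eq) auto
qed

lemma disc_fold_cnj: "cmod u = 1 \<Longrightarrow> u \<noteq> 1 \<Longrightarrow> disc_fold (cnj u) = disc_fold u"
  by (simp add: disc_fold_def cayley_cnj)

text \<open>Equal squares have equal or opposite roots. Opposite roots in the closed right
  half-plane are purely imaginary, hence come from the circle.\<close>

lemma disc_fold_eq:
  assumes "cmod u \<le> 1" "cmod v \<le> 1" "u \<noteq> 1" "v \<noteq> 1" "disc_fold u = disc_fold v"
  shows "v = u \<or> cmod u = 1 \<and> v = cnj u"
proof -
  have "(1 + u) / (1 - u) = (1 + v) / (1 - v) \<or> (1 + u) / (1 - u) = - ((1 + v) / (1 - v))"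
    using assms(5) by (simp add: disc_fold_def power2_eq_iff)
  then show ?thesis
  proof
    assume "(1 + u) / (1 - u) = - ((1 + v) / (1 - v))"
    moreover from this have "Re ((1 + u) / (1 - u)) = - Re ((1 + v) / (1 - v))" by simp
    moreover have "Re ((1 + u) / (1 - u)) \<ge> 0" "Re ((1 + v) / (1 - v)) \<ge> 0"
      unfolding Re_cayley using assms by (simp_all add: abs_square_le_1)
    ultimately have "Re ((1 + u) / (1 - u)) = 0" by linarith
    then have u: "cmod u = 1"
      unfolding Re_cayley using assms norm_ge_zero[of u] by (auto simp: power2_eq_1_iff simp del: norm_ge_zero)
    have "(1 + v) / (1 - v) = (1 + cnj u) / (1 - cnj u)"
      unfolding cayley_cnj[OF u assms(3)] using \<open>(1 + u) / (1 - u) = - ((1 + v) / (1 - v))\<close> by simp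
    moreover have "cnj u \<noteq> 1" using assms by (metis complex_cnj_cnj complex_cnj_one)
    ultimately have "v = cnj u" using cayley_inj assms by blast
    with u show ?thesis by simp
  qed (use cayley_inj assms in blast)
qed

text \<open>A square root of a negative number is purely imaginary. This is what puts the preimages
  of the branch values on the boundary.\<close>

lemma disc_fold_negative:
  assumes "disc_fold u = complex_of_real r" "r < 0" "u \<noteq> 1"
  shows "cmod u = 1"
proof -
  let ?m = "(1 + u) / (1 - u)"
  have "Re (?m\<^sup>2) = r" "Im (?m\<^sup>2) = 0" using assms by (simp_all add: disc_fold_def)
  then have "(Re ?m)\<^sup>2 - (Im ?m)\<^sup>2 < 0" "Re ?m * Im ?m = 0"
    using assms(2) by (simp_all add: Re_power2 Im_power2)
  then have "Re ?m = 0" by auto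
  then show ?thesis
    unfolding Re_cayley using assms norm_ge_zero[of u] by (auto simp: power2_eq_1_iff simp del: norm_ge_zero)
qed

lemma disc_fold_surj:
  obtains u where "cmod u \<le> 1" "u \<noteq> 1" "disc_fold u = c"
proof
  \<comment> \<open>The principal root lies in the closed right half-plane, and \<open>?u\<close> is
    its image under the inverse Cayley map.\<close>
  let ?w = "csqrt c"
  let ?u = "(?w - 1) / (?w + 1)"
  have r: "Re ?w \<ge> 0" using csqrt_principal[of c] by auto
  then have n: "?w + 1 \<noteq> 0" by (metis Re_complex_of_real add.commute add_nonneg_pos less_irrefl
        plus_complex.sel(1) one_complex.sel(1) zero_complex.sel(1) zero_less_one)
  have "(cmod (?w - 1))\<^sup>2 \<le> (cmod (?w + 1))\<^sup>2"
    unfolding cmod_power2 using r by (simp add: power2_eq_square algebra_simps)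
  then have "cmod (?w - 1) \<le> cmod (?w + 1)" by (simp add: power2_le_iff_abs_le)
  then show "cmod ?u \<le> 1" using n by (simp add: norm_divide divide_le_eq)
  show "?u \<noteq> 1" using n by (simp add: divide_eq_1_iff)
  have "1 + ?u = 2 * ?w / (?w + 1)" "1 - ?u = 2 / (?w + 1)"
    using n by (simp_all add: field_simps)
  then have "(1 + ?u) / (1 - ?u) = ?w" using n by simp
  then show "disc_fold ?u = c" by (simp add: disc_fold_def)
qed

lemma continuous_on_disc_fold: "1 \<notin> A \<Longrightarrow> continuous_on A disc_fold"
  unfolding disc_fold_def by (intro continuous_intros) auto

lemma filterlim_disc_fold: "filterlim disc_fold at_infinity (at 1 within A)"
proof -
  have "filterlim (\<lambda>u::complex. (1 + u) / (1 - u)) at_infinity (at 1)"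
  proof (rule filterlim_divide_at_infinity)
    show "((\<lambda>u::complex. 1 + u) \<longlongrightarrow> 1 + 1) (at 1)" by (intro tendsto_intros)
    show "filterlim (\<lambda>u::complex. 1 - u) (at 0) (at 1)"
      by (rule filterlim_atI) (auto intro!: tendsto_eq_intros simp: eventually_at_filter)
  qed simp
  then have "filterlim disc_fold at_infinity (at 1)"
    unfolding disc_fold_def power2_eq_square by (rule filterlim_at_infinity_times) fact
  then show ?thesis by (rule filterlim_mono) (auto simp: at_le)
qed

section \<open>Extension over finitely many boundary points\<close>

text \<open>The cluster set at \<open>\<zeta>\<close> is a decreasing intersection of continua, hence a point if it is finite.\<close>

lemma finite_cluster_set_limit:
  fixes L :: "'a::real_normed_vector \<Rightarrow> 'b::euclidean_space"
  assumes U: "convex U" "\<zeta> \<in> closure U" and L: "continuous_on U L" "L ` U \<subseteq> K" "compact K"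
    and E: "finite E" "\<And>u x. (\<And>n. u n \<in> U) \<Longrightarrow> u \<longlonglongrightarrow> \<zeta> \<Longrightarrow> (\<lambda>n. L (u n)) \<longlonglongrightarrow> x \<Longrightarrow> x \<in> E"
  shows "\<exists>l. (L \<longlongrightarrow> l) (at \<zeta> within U)"
proof -
  define S where "S n = closure (L ` (U \<inter> ball \<zeta> (1 / Suc n)))" for n :: nat
  have cS: "compact (S n)" for n
  proof -
    have "L ` (U \<inter> ball \<zeta> (1 / Suc n)) \<subseteq> K" using L(2) by blast
    then show ?thesis
      unfolding S_def by (metis L(3) bounded_subset compact_closure compact_imp_bounded)
  qed
  have nS: "S n \<noteq> {}" for n
  proof -
    have "U \<inter> ball \<zeta> (1 / Suc n) \<noteq> {}"
    proof -
      have "1 / real (Suc n) > 0" by simp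
      then obtain y where "y \<in> U" "dist y \<zeta> < 1 / Suc n"
        using U(2) unfolding closure_approachable by blast
      then have "y \<in> U \<inter> ball \<zeta> (1 / Suc n)" by (simp add: dist_commute)
      then show ?thesis by blast
    qed
    then show ?thesis by (simp add: S_def)
  qed
  have conS: "connected (S n)" for n
    unfolding S_def using U L
    by (intro connected_imp_connected_closure connected_continuous_image convex_connected convex_Int convex_ball)
      (auto intro: continuous_on_subset)
  have mono: "S n \<subseteq> S m" if "m \<le> n" for m n
    unfolding S_def using that by (intro closure_mono image_mono Int_mono subset_ball) (auto simp: frac_le)
  have sub: "\<Inter> (range S) \<subseteq> E"
  proof
    fix x assume "x \<in> \<Inter> (range S)"
    then have "\<exists>u. u \<in> U \<inter> ball \<zeta> (1 / Suc n) \<and> dist (L u) x < 1 / Suc n" for n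
    proof -
      have "x \<in> closure (L ` (U \<inter> ball \<zeta> (1 / Suc n)))"
        using \<open>x \<in> \<Inter> (range S)\<close> by (auto simp: S_def)
      moreover have "1 / real (Suc n) > 0" by simp
      ultimately show ?thesis
        unfolding closure_approachable by blast
    qed
    then obtain u where "\<And>n. u n \<in> U \<inter> ball \<zeta> (1 / Suc n) \<and> dist (L (u n)) x < 1 / Suc n"
      by metis
    then have u: "\<And>n. u n \<in> U" "\<And>n. dist \<zeta> (u n) < 1 / Suc n" "\<And>n. dist (L (u n)) x < 1 / Suc n"
      by auto
    have z: "(\<lambda>n. 1 / real (Suc n)) \<longlonglongrightarrow> 0" using LIMSEQ_inverse_real_of_nat by (simp add: inverse_eq_divide)
    have "u \<longlonglongrightarrow> \<zeta>" "(\<lambda>n. L (u n)) \<longlonglongrightarrow> x"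
      unfolding tendsto_dist_iff[of u] tendsto_dist_iff[of "\<lambda>n. L (u n)"]
      by (rule tendsto_sandwich[OF _ _ tendsto_const z]; use u in \<open>auto simp: dist_commute less_imp_le intro!: always_eventually\<close>)+
    then show "x \<in> E" using E u by blast
  qed
  have "\<Inter> (range S) \<noteq> {}" by (rule compact_nest) (use cS nS mono in auto)
  moreover have "connected (\<Inter> (range S))" by (rule connected_nest) (use cS conS mono in auto)
  ultimately obtain l where l: "\<Inter> (range S) = {l}"
    using sub E(1) by (metis connected_finite_iff_sing finite_subset)
  have "(L \<longlongrightarrow> l) (at \<zeta> within U)"
    unfolding tendsto_def
  proof (intro allI impI)
    fix V assume V: "open V" "l \<in> V"
    have "\<exists>n. S n - V = {}"
    proof (rule ccontr)
      assume ne: "\<nexists>n. S n - V = {}"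
      have "\<Inter> (range (\<lambda>n. S n - V)) \<noteq> {}"
      proof (rule compact_nest)
        show "compact (S n - V)" for n using cS V by (intro compact_diff)
        show "S n - V \<noteq> {}" for n using ne by blast
        show "S n - V \<subseteq> S m - V" if "m \<le> n" for m n using mono[OF that] by blast
      qed
      then show False using l V by blast
    qed
    then obtain n where "S n \<subseteq> V" by blast
    then have "L u \<in> V" if "u \<in> U" "dist u \<zeta> < 1 / Suc n" for u
    proof -
      have "u \<in> U \<inter> ball \<zeta> (1 / Suc n)" using that by (simp add: dist_commute)
      then have "L u \<in> S n" unfolding S_def by (intro subsetD[OF closure_subset] imageI)
      then show ?thesis using \<open>S n \<subseteq> V\<close> by blast
    qed
    then show "\<forall>\<^sub>F x in at \<zeta> within U. L x \<in> V"
      unfolding eventually_at by (intro exI[of _ "1 / real (Suc n)"]) simp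
  qed
  then show ?thesis by (rule exI)
qed

lemma continuous_on_extend_finite:
  fixes L :: "'a::t2_space \<Rightarrow> 'b::topological_space"
  assumes E: "finite E" and L: "continuous_on (D - E) L"
    and lim: "\<And>\<zeta>. \<zeta> \<in> D \<inter> E \<Longrightarrow> (L \<longlongrightarrow> l \<zeta>) (at \<zeta> within D - E)"
  shows "continuous_on D (\<lambda>u. if u \<in> E then l u else L u)" (is "continuous_on D ?L")
  unfolding continuous_on_def
proof
  fix u assume u: "u \<in> D"
  have "(L \<longlongrightarrow> ?L u) (at u within D - E)"
  proof (cases "u \<in> E")
    case True
    then show ?thesis using lim u by simp
  next
    case False
    then show ?thesis using L u unfolding continuous_on_def by simp
  qed
  moreover have "\<forall>\<^sub>F x in at u within D - E. L x = ?L x"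
    by (simp add: eventually_at_filter)
  ultimately have "(?L \<longlongrightarrow> ?L u) (at u within D - E)"
    by (rule Lim_transform_eventually)
  \<comment> \<open>The other points of the finite set \<open>E\<close> keep a positive distance
    from \<open>u\<close>, so removing them does not affect limits there.\<close>
  moreover have "at u within D - E = at u within D"
  proof (rule antisym)
    show "at u within D - E \<le> at u within D" by (rule at_le) auto
    have "open (- (E - {u}))" using E by (intro open_Compl finite_imp_closed) auto
    then have "\<forall>\<^sub>F x in nhds u. x \<in> - (E - {u})" by (intro eventually_nhds_in_open) auto
    then show "at u within D \<le> at u within D - E"
      unfolding le_filter_def eventually_at_filter by (auto elim: eventually_elim2)
  qed
  ultimately show "(?L \<longlongrightarrow> ?L u) (at u within D)" by simp
qed

section \<open>The covering by regular points\<close>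

text \<open>These are properties that survive composing the invariant map with a homeomorphism of
  the plane, together with the position of the branch values, which that homeomorphism arranges. The
  orbit of \<open>b\<close> stands for the fibre over \<infinity>.\<close>

locale orbit_map = finite_rotation_group +
  fixes b :: "real^3" and F :: "real^3 \<Rightarrow> complex"
  assumes b: "b \<in> sphere 0 1" "b \<notin> singular_points"
    and cont: "continuous_on (sphere 0 1 - orb b) F"
    and F_act: "g \<in> \<Gamma> \<Longrightarrow> F (g *v x) = F x"
    and F_fibre: "x \<in> sphere 0 1 - orb b \<Longrightarrow> y \<in> sphere 0 1 - orb b \<Longrightarrow> F x = F y \<Longrightarrow> y \<in> orb x"
    and F_surj: "F ` (sphere 0 1 - orb b) = UNIV"
    and F_proper: "compact {x \<in> sphere 0 1 - orb b. norm (F x) \<le> r}"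
    and F_open: "open V \<Longrightarrow> open (F ` ((sphere 0 1 - orb b) \<inter> V))"
    and F_singular: "x \<in> singular_points \<Longrightarrow> \<exists>r<0. F x = complex_of_real r"
begin

definition regular :: "(real^3) set"
  where "regular = sphere 0 1 - orb b - singular_points"

lemma regular_act: "g \<in> \<Gamma> \<Longrightarrow> g *v x \<in> regular \<longleftrightarrow> x \<in> regular"
  by (simp add: regular_def orb_act act_singular_points)

lemma regular_inj: "x \<in> regular \<Longrightarrow> g \<in> \<Gamma> \<Longrightarrow> h \<in> \<Gamma> \<Longrightarrow> g *v x = h *v x \<Longrightarrow> g = h"
  using act_inj_regular by (auto simp: regular_def)

lemma regular_sub: "regular \<subseteq> sphere 0 1 - orb b"
  by (auto simp: regular_def)

text \<open>Fibres are orbits, and an orbit is either entirely singular or entirely regular.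
  Deleting the singular points therefore is the same as deleting their values.\<close>

lemma F_regular: "x \<in> sphere 0 1 - orb b \<Longrightarrow> F x \<in> F ` singular_points \<longleftrightarrow> x \<notin> regular"
proof -
  assume x: "x \<in> sphere 0 1 - orb b"
  have "x \<in> singular_points" if "y \<in> singular_points" "F x = F y" for y
  proof -
    have "y \<notin> orb b"
      using that b act_singular_points by (auto simp: orb_def)
    then have "x \<in> orb y"
      using F_fibre[of y x] x that by (auto simp: singular_points_def)
    then show ?thesis using that act_singular_points by (auto simp: orb_def)
  qed
  then show ?thesis using x by (auto simp: regular_def)
qed

lemma F_regularI: "x \<in> regular \<Longrightarrow> F x \<notin> F ` singular_points"
  using F_regular regular_sub by (metis subsetD)

lemma F_regularD: "x \<in> sphere 0 1 - orb b \<Longrightarrow> F x \<notin> F ` singular_points \<Longrightarrow> x \<in> regular"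
  using F_regular by metis

lemma F_orbE:
  assumes "x \<in> regular" "y \<in> regular" "F x = F y"
  obtains g where "g \<in> \<Gamma>" "y = g *v x"
proof -
  have "y \<in> orb x" using assms F_fibre[of x y] by (auto simp: regular_def)
  then show thesis using that by (auto simp: orb_def)
qed

lemma open_act_image: "g \<in> \<Gamma> \<Longrightarrow> open W \<Longrightarrow> open ((*v) g ` W)"
proof -
  assume g: "g \<in> \<Gamma>" and W: "open W"
  have "(*v) g ` W = (*v) (transpose g) -` W"
    using g inv[OF g] by (auto simp: image_iff) (metis transpose_mult_vec(2))
  then show ?thesis
    using W by (simp add: open_vimage linear_continuous_on matrix_vector_mul_bounded_linear)
qed

text \<open>Distinct translates of such a set are disjoint; they will be the sheets of the
  covering.\<close>

definition small :: "(real^3) set \<Rightarrow> bool"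
  where "small W \<longleftrightarrow> open W \<and> (\<forall>v\<in>W. \<forall>g\<in>\<Gamma>. g *v v \<in> W \<longrightarrow> g = mat 1)"

lemma small_act:
  assumes "small W" "g \<in> \<Gamma>"
  shows "small ((*v) g ` W)"
  unfolding small_def
proof (intro conjI ballI impI)
  show "open ((*v) g ` W)" using assms open_act_image by (simp add: small_def)
  fix v h assume "v \<in> (*v) g ` W" "h \<in> \<Gamma>" "h *v v \<in> (*v) g ` W"
  then obtain w w' where w: "w \<in> W" "v = g *v w" "w' \<in> W" "h *v (g *v w) = g *v w'" by auto
  have "transpose g ** h ** g = mat 1"
  proof -
    have "(transpose g ** h ** g) *v w = w'"
      using w assms by (simp flip: matrix_vector_mul_assoc)
    moreover have "transpose g ** h ** g \<in> \<Gamma>" using assms \<open>h \<in> \<Gamma>\<close> inv mult by simp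
    ultimately show ?thesis using assms(1) w unfolding small_def by metis
  qed
  then have "g ** (transpose g ** h ** g) ** transpose g = g ** transpose g" by simp
  moreover have "g ** (transpose g ** h ** g) ** transpose g = (g ** transpose g) ** h ** (g ** transpose g)"
    by (simp only: matrix_mul_assoc)
  ultimately show "h = mat 1" using assms by (simp add: transpose_mult)
qed

text \<open>A regular point differs from each of its finitely many nontrivial translates. Separating
  it from all of them and intersecting gives the neighbourhood.\<close>

lemma small_neighbourhood:
  assumes "x \<in> regular"
  obtains W where "small W" "x \<in> W"
proof -
  have "\<exists>U V. open U \<and> open V \<and> x \<in> U \<and> g *v x \<in> V \<and> U \<inter> V = {}" if "g \<in> \<Gamma> - {mat 1}" for g
    using regular_inj[OF assms, of g "mat 1"] that one by (intro hausdorff) auto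
  then obtain U V where UV: "\<And>g. g \<in> \<Gamma> - {mat 1} \<Longrightarrow>
      open (U g) \<and> open (V g) \<and> x \<in> U g \<and> g *v x \<in> V g \<and> U g \<inter> V g = {}"
    by metis
  let ?W = "\<Inter>g\<in>\<Gamma> - {mat 1}. U g \<inter> (*v) g -` V g"
  show thesis
  proof
    show "x \<in> ?W" using UV by auto
    have "open ?W"
      using fin UV by (intro open_INT ballI open_Int open_vimage)
        (auto intro: linear_continuous_on matrix_vector_mul_bounded_linear)
    moreover have "g = mat 1" if v: "v \<in> ?W" and g: "g \<in> \<Gamma>" and gv: "g *v v \<in> ?W" for v g
    proof (rule ccontr)
      assume "g \<noteq> mat 1"
      with g have "g \<in> \<Gamma> - {mat 1}" by blast
      with v gv have "g *v v \<in> U g \<inter> V g" by blast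
      then show False using UV[OF \<open>g \<in> \<Gamma> - {mat 1}\<close>] by blast
    qed
    ultimately show "small ?W" unfolding small_def by blast
  qed
qed

lemma F_regular_open:
  assumes "open V"
  shows "openin (top_of_set (- F ` singular_points)) (F ` (regular \<inter> V))"
proof -
  have "F ` (regular \<inter> V) = - F ` singular_points \<inter> F ` ((sphere 0 1 - orb b) \<inter> V)"
  proof
    show "F ` (regular \<inter> V) \<subseteq> - F ` singular_points \<inter> F ` ((sphere 0 1 - orb b) \<inter> V)"
      using F_regularI regular_sub by auto
    show "- F ` singular_points \<inter> F ` ((sphere 0 1 - orb b) \<inter> V) \<subseteq> F ` (regular \<inter> V)"
    proof
      fix y assume y: "y \<in> - F ` singular_points \<inter> F ` ((sphere 0 1 - orb b) \<inter> V)"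
      then obtain x where "x \<in> sphere 0 1 - orb b" "x \<in> V" "y = F x" by auto
      then show "y \<in> F ` (regular \<inter> V)" using F_regularD[of x] y by auto
    qed
  qed
  then show ?thesis
    using F_open[OF assms] by (simp add: openin_open_Int)
qed

lemma small_homeomorphism:
  assumes W: "small W"
  shows "\<exists>q. homeomorphism (regular \<inter> W) (F ` (regular \<inter> W)) F q"
proof -
  have "inj_on F (regular \<inter> W)"
  proof
    fix v w assume vw: "v \<in> regular \<inter> W" "w \<in> regular \<inter> W" "F v = F w"
    then obtain g where "g \<in> \<Gamma>" "w = g *v v"
      using F_orbE[of v w] by blast
    moreover have "g = mat 1" using vw W \<open>g \<in> \<Gamma>\<close> \<open>w = g *v v\<close> unfolding small_def by blast
    ultimately show "v = w" by simp
  qed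
  moreover have "continuous_on (regular \<inter> W) F"
    using cont regular_sub by (auto intro: continuous_on_subset)
  moreover have "openin (top_of_set (F ` (regular \<inter> W))) (F ` U)" if "openin (top_of_set (regular \<inter> W)) U" for U
  proof -
    obtain V where V: "open V" "U = regular \<inter> W \<inter> V" using \<open>openin _ U\<close> unfolding openin_open by blast
    then have "openin (top_of_set (- F ` singular_points)) (F ` U)"
      using F_regular_open[of "W \<inter> V"] W by (simp add: small_def open_Int Int_assoc)
    then show ?thesis
      by (rule openin_subset_trans) (use V F_regularI in auto)
  qed
  ultimately show ?thesis
    using homeomorphism_injective_open_map[of "regular \<inter> W" F] by blast
qed

text \<open>The image of a small set is evenly covered: the fibres are orbits, so its preimage is
  the union of the translates, and \<open>F\<close> is open and injective on each of them.\<close>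

lemma covering: "covering_space regular F (- F ` singular_points)"
  unfolding covering_space_def
proof (intro conjI ballI)
  show "continuous_on regular F"
    using cont regular_sub by (rule continuous_on_subset)
  show im: "F ` regular = - F ` singular_points"
  proof
    show "F ` regular \<subseteq> - F ` singular_points" using F_regularI by auto
    show "- F ` singular_points \<subseteq> F ` regular"
    proof
      fix y assume y: "y \<in> - F ` singular_points"
      obtain x where "x \<in> sphere 0 1 - orb b" "y = F x" using F_surj by blast
      then show "y \<in> F ` regular" using y F_regularD[of x] by auto
    qed
  qed
  fix y assume "y \<in> - F ` singular_points"
  then obtain x where x: "x \<in> regular" "y = F x" using im by blast
  obtain W where W: "small W" "x \<in> W" using small_neighbourhood[OF x(1)] .
  let ?T = "F ` (regular \<inter> W)"
  let ?v = "(\<lambda>g. regular \<inter> (*v) g ` W) ` \<Gamma>"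
  have Fg: "F ` (regular \<inter> (*v) g ` W) = ?T" if g: "g \<in> \<Gamma>" for g
  proof -
    have "regular \<inter> (*v) g ` W = (*v) g ` (regular \<inter> W)"
      using regular_act[OF g] by auto
    then show ?thesis using F_act[OF g] by (simp add: image_image)
  qed
  show "\<exists>T. y \<in> T \<and> openin (top_of_set (- F ` singular_points)) T \<and>
      (\<exists>v. \<Union>v = regular \<inter> F -` T \<and> (\<forall>u\<in>v. openin (top_of_set regular) u) \<and>
        pairwise disjnt v \<and> (\<forall>u\<in>v. \<exists>q. homeomorphism u T F q))"
  proof (intro exI[of _ ?T] exI[of _ ?v] conjI ballI)
    show "y \<in> ?T" using x W by blast
    show "openin (top_of_set (- F ` singular_points)) ?T"
      using F_regular_open W by (simp add: small_def)
    show "\<Union> ?v = regular \<inter> F -` ?T"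
    proof
      show "\<Union> ?v \<subseteq> regular \<inter> F -` ?T" using Fg by blast
      show "regular \<inter> F -` ?T \<subseteq> \<Union> ?v"
      proof
        fix z assume z: "z \<in> regular \<inter> F -` ?T"
        then obtain w where w: "w \<in> regular \<inter> W" "F z = F w" by blast
        then obtain g where "g \<in> \<Gamma>" "z = g *v w"
          using F_orbE[of w z] z by (metis IntE)
        then show "z \<in> \<Union> ?v" using w z by blast
      qed
    qed
    show "openin (top_of_set regular) u" if "u \<in> ?v" for u
      using that open_act_image W by (auto simp: small_def intro!: openin_open_Int)
    show "pairwise disjnt ?v"
      unfolding pairwise_image
    proof (intro pairwiseI impI)
      fix g h assume gh: "g \<in> \<Gamma>" "h \<in> \<Gamma>" "g \<noteq> h"
      have "g = h" if "w \<in> W" "w' \<in> W" "g *v w = h *v w'" for w w'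
      proof -
        have "(transpose h ** g) *v w = w'"
          using that gh by (simp flip: matrix_vector_mul_assoc)
        moreover have "transpose h ** g \<in> \<Gamma>" using gh inv mult by simp
        ultimately have "transpose h ** g = mat 1"
          using W(1) that unfolding small_def by metis
        then have "h ** (transpose h ** g) = h" by simp
        then show ?thesis using gh by (simp add: matrix_mul_assoc transpose_mult)
      qed
      then show "disjnt (regular \<inter> (*v) g ` W) (regular \<inter> (*v) h ` W)"
        using gh by (auto simp: disjnt_def)
    qed
    show "\<exists>q. homeomorphism u ?T F q" if u: "u \<in> ?v" for u
    proof -
      obtain g where "g \<in> \<Gamma>" "u = regular \<inter> (*v) g ` W" using u by (rule imageE)
      then show ?thesis using small_homeomorphism[OF small_act[OF W(1)], of g] Fg[of g] by metis
    qed
  qed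
qed


section \<open>Lifting the folded disc\<close>

text \<open>Boundary points over branch values, together with 1, which lies over
  \<infinity>.\<close>

definition marked :: "complex set"
  where "marked = insert 1 {u \<in> cball 0 1. u \<noteq> 1 \<and> disc_fold u \<in> F ` singular_points}"

lemma marked_sphere: "marked \<subseteq> sphere 0 1"
proof
  fix u assume u: "u \<in> marked"
  show "u \<in> sphere 0 1"
  proof (cases "u = 1")
    case False
    then obtain x where x: "x \<in> singular_points" "disc_fold u = F x"
      using u by (auto simp: marked_def)
    then show ?thesis
      using F_singular[OF x(1)] disc_fold_negative[of u] False by auto
  qed simp
qed

lemma finite_disc_fold_fibre: "finite {u \<in> cball 0 1. u \<noteq> 1 \<and> disc_fold u = c}"
proof (cases "\<exists>u. u \<in> cball 0 1 \<and> u \<noteq> 1 \<and> disc_fold u = c")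
  case True
  then obtain u where u: "cmod u \<le> 1" "u \<noteq> 1" "disc_fold u = c" by auto
  have "v \<in> {u, cnj u}" if "cmod v \<le> 1" "v \<noteq> 1" "disc_fold v = c" for v
    using disc_fold_eq[of u v] u that by auto
  then have "{u \<in> cball 0 1. u \<noteq> 1 \<and> disc_fold u = c} \<subseteq> {u, cnj u}" by auto
  then show ?thesis by (rule finite_subset) simp
next
  case False
  then have "{u \<in> cball 0 1. u \<noteq> 1 \<and> disc_fold u = c} = {}" by blast
  then show ?thesis by (simp only: finite.emptyI)
qed

lemma finite_marked: "finite marked"
proof -
  have "marked = insert 1 (\<Union>c\<in>F ` singular_points. {u \<in> cball 0 1. u \<noteq> 1 \<and> disc_fold u = c})"
    by (auto simp: marked_def)
  then show ?thesis
    using finite_disc_fold_fibre finite_singular_points by simp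
qed

text \<open>Only points of the circle are removed, and every set between an open ball and its
  closure is convex. The lifting domain is thus simply connected, which is why the branch values had
  to sit on the seam.\<close>

lemma convex_unmarked: "convex (cball 0 1 - marked)"
  by (rule convex_intermediate_ball[of 0 1]) (use marked_sphere in auto)

text \<open>A cluster value of the lift lies over \<open>disc_fold \<zeta>\<close>. At
  \<open>\<zeta> = 1\<close> the folding tends to \<infinity>, so that only \<open>orb b\<close>
  remains; elsewhere it stays bounded along the sequence and properness keeps \<open>x\<close> away
  from \<open>orb b\<close>.\<close>

lemma lift_limit:
  assumes L: "L \<in> cball 0 1 - marked \<rightarrow> regular" "\<And>u. u \<in> cball 0 1 - marked \<Longrightarrow> F (L u) = disc_fold u"
    and u: "\<And>n. u n \<in> cball 0 1 - marked" "u \<longlonglongrightarrow> \<zeta>" and x: "(\<lambda>n. L (u n)) \<longlonglongrightarrow> x"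
  shows "if \<zeta> = 1 then x \<in> orb b else x \<in> sphere 0 1 - orb b \<and> F x = disc_fold \<zeta>"
proof -
  have reg: "L (u n) \<in> sphere 0 1 - orb b" for n using L(1) u(1) regular_sub by blast
  have "x \<in> sphere 0 1"
    using closed_sphere x reg by (metis closed_sequentially DiffD1)
  have FL: "F (L (u n)) = disc_fold (u n)" for n using L(2) u(1) by blast
  have ne: "u n \<noteq> 1" for n using u(1)[of n] by (auto simp: marked_def)
  have conv: "(\<lambda>n. F (L (u n))) \<longlonglongrightarrow> F x" if "x \<in> sphere 0 1 - orb b"
    using continuous_on_tendsto_compose[OF cont x that] reg by simp
  show ?thesis
  proof (cases "\<zeta> = 1")
    case True
    have "filterlim u (at 1) sequentially"
      using u(2) ne True by (simp add: filterlim_at)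
    then have "filterlim (\<lambda>n. disc_fold (u n)) at_infinity sequentially"
      by (rule filterlim_compose[OF filterlim_disc_fold])
    then have "\<not> (\<lambda>n. F (L (u n))) \<longlonglongrightarrow> F x"
      unfolding FL using not_tendsto_and_filterlim_at_infinity[OF sequentially_bot] by blast
    then show ?thesis using True conv \<open>x \<in> sphere 0 1\<close> by auto
  next
    case False
    have "isCont disc_fold \<zeta>"
      using continuous_on_disc_fold[of "- {1}"] False by (simp add: continuous_on_eq_continuous_at open_Compl)
    then have lim: "(\<lambda>n. disc_fold (u n)) \<longlonglongrightarrow> disc_fold \<zeta>"
      using u(2) by (rule isCont_tendsto_compose)
    then obtain r where r: "\<And>n. norm (disc_fold (u n)) \<le> r"
      by (metis Bseq_def convergentI convergent_imp_Bseq)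
    have "L (u n) \<in> {x \<in> sphere 0 1 - orb b. norm (F x) \<le> r}" for n
      using reg[of n] r[of n] by (simp add: FL)
    then have "x \<in> {x \<in> sphere 0 1 - orb b. norm (F x) \<le> r}"
      using closed_sequentially[OF compact_imp_closed[OF F_proper] _ x] by blast
    then have "x \<in> sphere 0 1 - orb b" by blast
    then show ?thesis
      using conv lim False LIMSEQ_unique unfolding FL by auto
  qed
qed

lemma finite_F_fibre: "finite {x \<in> sphere 0 1 - orb b. F x = c}"
proof (cases "\<exists>y. y \<in> sphere 0 1 - orb b \<and> F y = c")
  case True
  then obtain y where "y \<in> sphere 0 1 - orb b" "F y = c" by blast
  then have "{x \<in> sphere 0 1 - orb b. F x = c} \<subseteq> orb y" using F_fibre by auto
  then show ?thesis by (rule finite_subset) simp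
next
  case False
  then have "{x \<in> sphere 0 1 - orb b. F x = c} = {}" by blast
  then show ?thesis by (simp only: finite.emptyI)
qed

text \<open>Cluster values at a boundary point belong to a finite set, namely one fibre or
  \<open>orb b\<close>. Hence the lift has a limit at every marked point and extends.\<close>

lemma disc_lift:
  "\<exists>L. continuous_on (cball 0 1) L \<and> (\<forall>u\<in>cball 0 1.
    if u = 1 then L u \<in> orb b else L u \<in> sphere 0 1 - orb b \<and> F (L u) = disc_fold u)"
proof -
  let ?U = "cball 0 1 - marked :: complex set"
  have "disc_fold \<in> ?U \<rightarrow> - F ` singular_points"
    by (auto simp: marked_def)
  moreover have "continuous_on ?U disc_fold"
    by (rule continuous_on_disc_fold) (auto simp: marked_def)
  ultimately obtain L where L: "continuous_on ?U L" "L \<in> ?U \<rightarrow> regular" "\<And>u. u \<in> ?U \<Longrightarrow> F (L u) = disc_fold u"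
    using covering_space_lift[OF covering convex_imp_simply_connected[OF convex_unmarked]
        convex_imp_locally_path_connected[OF convex_unmarked]] by metis
  have cl: "\<zeta> \<in> closure ?U" if "\<zeta> \<in> cball 0 1" for \<zeta>
  proof -
    have "ball 0 1 \<subseteq> ?U" using marked_sphere by auto
    then have "closure (ball 0 1) \<subseteq> closure ?U" by (rule closure_mono)
    then show ?thesis using that by auto
  qed
  have "\<exists>l. (L \<longlongrightarrow> l) (at \<zeta> within ?U)" if \<zeta>: "\<zeta> \<in> cball 0 1" for \<zeta>
  proof (rule finite_cluster_set_limit[OF convex_unmarked cl[OF \<zeta>] L(1)])
    show "L ` ?U \<subseteq> sphere 0 1" using L(2) regular_sub by blast
    show "finite (orb b \<union> {x \<in> sphere 0 1 - orb b. F x = disc_fold \<zeta>})"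
      using finite_F_fibre by simp
    show "x \<in> orb b \<union> {x \<in> sphere 0 1 - orb b. F x = disc_fold \<zeta>}"
      if "\<And>n. u n \<in> ?U" "u \<longlonglongrightarrow> \<zeta>" "(\<lambda>n. L (u n)) \<longlonglongrightarrow> x" for u x
      using lift_limit[OF L(2,3) that] by (auto split: if_splits)
  qed simp
  then obtain l where l: "\<And>\<zeta>. \<zeta> \<in> cball 0 1 \<Longrightarrow> (L \<longlongrightarrow> l \<zeta>) (at \<zeta> within ?U)" by metis
  let ?L = "\<lambda>u. if u \<in> marked then l u else L u"
  show ?thesis
  proof (intro exI conjI ballI)
    show "continuous_on (cball 0 1) ?L"
      by (rule continuous_on_extend_finite[OF finite_marked L(1)]) (use l in auto)
    fix \<zeta> :: complex assume \<zeta>: "\<zeta> \<in> cball 0 1"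
    show "if \<zeta> = 1 then ?L \<zeta> \<in> orb b else ?L \<zeta> \<in> sphere 0 1 - orb b \<and> F (?L \<zeta>) = disc_fold \<zeta>"
    proof (cases "\<zeta> \<in> marked")
      case True
      then obtain u where u: "\<And>n. u n \<in> ?U" "u \<longlonglongrightarrow> \<zeta>"
        using cl[OF \<zeta>] by (auto simp: closure_sequential)
      \<comment> \<open>A sequence of unmarked points never hits the marked point \<zeta>, as
        convergence within a punctured neighbourhood demands.\<close>
      have "filterlim u (at \<zeta> within ?U) sequentially"
        unfolding filterlim_at using u True by (auto intro!: always_eventually)
      then have "(\<lambda>n. L (u n)) \<longlonglongrightarrow> l \<zeta>"
        by (rule filterlim_compose[OF l[OF \<zeta>]])
      then have "if \<zeta> = 1 then l \<zeta> \<in> orb b else l \<zeta> \<in> sphere 0 1 - orb b \<and> F (l \<zeta>) = disc_fold \<zeta>"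
        using lift_limit[of L u \<zeta> "l \<zeta>"] L(2,3) u by blast
      then show ?thesis unfolding if_P[OF True] .
    next
      case False
      then have "\<zeta> \<in> ?U" "\<zeta> \<noteq> 1" using \<zeta> by (auto simp: marked_def)
      moreover from this have "L \<zeta> \<in> sphere 0 1 - orb b" using L(2) regular_sub by blast
      ultimately show ?thesis using L(3)[of \<zeta>] False by auto
    qed
  qed
qed

lemma fundamental_disc_lift: "\<exists>L. fundamental_disc_map \<Gamma> L"
proof -
  obtain L where L: "continuous_on (cball 0 1) L" 
    "\<And>u. u \<in> cball 0 1 \<Longrightarrow> if u = 1 then L u \<in> orb b else L u \<in> sphere 0 1 - orb b \<and> F (L u) = disc_fold u"
    using disc_lift by blast
  have L1: "L 1 \<in> orb b" using L(2)[of 1] by simp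
  have Lu: "L u \<in> sphere 0 1 - orb b" "F (L u) = disc_fold u" if "cmod u \<le> 1" "u \<noteq> 1" for u
    using L(2)[of u] that by auto
  have sing: "u \<in> marked" if "u \<in> cball 0 1" "L u \<in> singular_points" for u
  proof (cases "u = 1")
    case False
    then have "F (L u) = disc_fold u" using Lu(2)[of u] that by simp
    then have "disc_fold u \<in> F ` singular_points" using that(2) by (metis imageI)
    then show ?thesis using that False by (simp add: marked_def)
  qed (simp add: marked_def)
  have "fundamental_disc_map \<Gamma> L"
  proof
    show "L ` cball 0 1 \<subseteq> sphere 0 1"
    proof
      fix y assume "y \<in> L ` cball 0 1"
      then obtain u where "cmod u \<le> 1" "y = L u" by auto
      then show "y \<in> sphere 0 1"
        using Lu(1)[of u] L1 orb_subset_sphere[OF b(1)] by (cases "u = 1") auto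
    qed
    show "\<exists>u\<in>cball 0 1. L u \<in> orb x" if x: "x \<in> sphere 0 1" for x
    proof (cases "x \<in> orb b")
      case True
      then have "L 1 \<in> orb x" using L1 orb_sym orb_trans by blast
      then show ?thesis by (intro bexI[of _ 1]) auto
    next
      case False
      obtain u where u: "cmod u \<le> 1" "u \<noteq> 1" "disc_fold u = F x" by (rule disc_fold_surj)
      then have "L u \<in> orb x" using F_fibre[of x "L u"] Lu[of u] x False by simp
      then show ?thesis using u by (intro bexI[of _ u]) auto
    qed
    show "v = u \<or> cmod u = 1 \<and> v = cnj u"
      if "u \<in> cball 0 1" "v \<in> cball 0 1" "L v \<in> orb (L u)" for u v
    proof -
      have "L v \<in> orb b \<longleftrightarrow> L u \<in> orb b" using that(3) orb_sym orb_trans by blast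
      \<comment> \<open>Only \<open>u = 1\<close> is sent into \<open>orb b\<close>, so the junk
        value \<open>disc_fold 1\<close> is never compared with a genuine one.\<close>
      then have "v = 1 \<longleftrightarrow> u = 1" using L1 Lu(1)[of u] Lu(1)[of v] that by auto
      moreover have "disc_fold u = disc_fold v" if "u \<noteq> 1" "v \<noteq> 1"
      proof -
        obtain g where "g \<in> \<Gamma>" "L v = g *v L u" using \<open>L v \<in> orb (L u)\<close> by (auto simp: orb_def)
        then have "F (L v) = F (L u)" by (simp add: F_act)
        then show ?thesis using Lu(2) that \<open>u \<in> cball 0 1\<close> \<open>v \<in> cball 0 1\<close> by simp
      qed
      ultimately show ?thesis using disc_fold_eq[of u v] that by auto
    qed
    show "L (cnj u) \<in> orb (L u)" if u: "cmod u = 1" for u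
    proof (cases "u = 1")
      case False
      then have "cnj u \<noteq> 1" by (metis complex_cnj_cnj complex_cnj_one)
      then show ?thesis
        using F_fibre[of "L u" "L (cnj u)"] Lu[of u] Lu[of "cnj u"] disc_fold_cnj[of u] u False by simp
    qed simp
    show "finite {u \<in> cball 0 1. L u \<in> singular_points}"
      by (rule finite_subset[OF _ finite_marked]) (use sing in auto)
    show "{u \<in> cball 0 1. L u \<in> singular_points} \<subseteq> sphere 0 1"
      using sing marked_sphere by blast
  qed (rule L(1))
  then show ?thesis by blast
qed

end

section \<open>Moving the branch values to the negative axis\<close>

context rotation_group_regular_point
begin

lemma invariant_map_straightened:
  obtains \<Psi> where "orbit_map \<Gamma> b (\<Psi> \<circ> invariant_map)"
proof -
  let ?B = "invariant_map ` singular_points"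
  have fB: "finite ?B" using finite_singular_points by simp
  then obtain idx :: "complex \<Rightarrow> nat" where idx: "inj_on idx ?B"
    using finite_imp_inj_to_nat_seg by metis
  \<comment> \<open>An injective enumeration of the branch values gives them distinct targets on the
    negative axis; the shift by 1 keeps the index 0 away from the origin.\<close>
  define y where "y c = complex_of_real (- 1 - real (idx c))" for c
  have y: "pairwise (\<lambda>i j. i \<noteq> j \<and> y i \<noteq> y j) ?B"
    using idx unfolding pairwise_def y_def inj_on_def of_real_eq_iff by fastforce
  \<comment> \<open>In the plane, finitely many points can be moved to any equally many distinct
    points by a homeomorphism.\<close>
  obtain \<Psi> \<Psi>' where \<Psi>: "homeomorphism UNIV UNIV \<Psi> \<Psi>'" "\<And>c. c \<in> ?B \<Longrightarrow> \<Psi> c = y c"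
    by (rule homeomorphism_moving_points_exists[of "UNIV :: complex set" UNIV ?B "\<lambda>c. c" y])
      (use fB y in \<open>auto simp: y_def\<close>)
  have cont: "continuous_on UNIV \<Psi>" "continuous_on UNIV \<Psi>'"
    using \<Psi>(1) by (auto simp: homeomorphism_def)
  have inv: "\<Psi>' (\<Psi> c) = c" "\<Psi> (\<Psi>' c) = c" for c
    using \<Psi>(1) by (auto simp: homeomorphism_def)
  have contF: "continuous_on punctured_sphere (\<Psi> \<circ> invariant_map)"
    by (intro continuous_on_compose continuous_on_invariant_map continuous_on_subset[OF cont(1)]) simp
  have "orbit_map \<Gamma> b (\<Psi> \<circ> invariant_map)"
  proof
    show "b \<in> sphere 0 1" "b \<notin> singular_points" using b by auto
    show "continuous_on punctured_sphere (\<Psi> \<circ> invariant_map)" by (rule contF)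
    show "(\<Psi> \<circ> invariant_map) (g *v x) = (\<Psi> \<circ> invariant_map) x" if "g \<in> \<Gamma>" for g x
      using invariant_map_act[OF that] by simp
    show "y \<in> orb x" if "x \<in> punctured_sphere" "y \<in> punctured_sphere"
      "(\<Psi> \<circ> invariant_map) x = (\<Psi> \<circ> invariant_map) y" for x y
    proof -
      have "invariant_map x = invariant_map y" using that(3) inv(1) by (metis comp_apply)
      then show ?thesis using invariant_map_eq_imp_orb that by blast
    qed
    have "range \<Psi> = UNIV" using inv(2) by (metis surjI)
    then show "(\<Psi> \<circ> invariant_map) ` punctured_sphere = UNIV"
      by (simp only: image_comp[symmetric] invariant_map_surj)
    show "compact {x \<in> punctured_sphere. norm ((\<Psi> \<circ> invariant_map) x) \<le> r}" for r
    proof -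
      \<comment> \<open>Properness passes through the homeomorphism because its inverse carries
        closed balls to bounded sets.\<close>
      have "compact (\<Psi>' ` cball 0 r)"
        using cont(2) by (intro compact_continuous_image) (auto intro: continuous_on_subset)
      then obtain s where s: "\<And>c. c \<in> \<Psi>' ` cball 0 r \<Longrightarrow> norm c \<le> s"
        by (metis compact_imp_bounded bounded_iff)
      let ?K = "{x \<in> punctured_sphere. norm (invariant_map x) \<le> s}"
      have eq: "{x \<in> punctured_sphere. norm ((\<Psi> \<circ> invariant_map) x) \<le> r} = ?K \<inter> (\<Psi> \<circ> invariant_map) -` cball 0 r"
      proof -
        have "norm (invariant_map x) \<le> s" if "norm (\<Psi> (invariant_map x)) \<le> r" for x
        proof (rule s)
          show "invariant_map x \<in> \<Psi>' ` cball 0 r"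
            using inv(1) that by (intro image_eqI[of _ _ "\<Psi> (invariant_map x)"]) auto
        qed
        then show ?thesis by auto
      qed
      have "continuous_on ?K (\<Psi> \<circ> invariant_map)"
        using contF by (rule continuous_on_subset) auto
      then have "closedin (top_of_set ?K) (?K \<inter> (\<Psi> \<circ> invariant_map) -` cball 0 r)"
        by (rule continuous_closedin_preimage) simp
      then show ?thesis
        unfolding eq using closedin_compact compact_invariant_map_bounded by blast
    qed
    show "open ((\<Psi> \<circ> invariant_map) ` (punctured_sphere \<inter> V))" if "open V" for V
    proof -
      have "openin (top_of_set UNIV) (\<Psi> ` (invariant_map ` (punctured_sphere \<inter> V)))"
        using open_invariant_map[OF that] by (intro homeomorphism_imp_open_map[OF \<Psi>(1)]) auto
      then show ?thesis by (simp add: image_comp)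
    qed
    show "\<exists>r<0. (\<Psi> \<circ> invariant_map) x = complex_of_real r" if "x \<in> singular_points" for x
      using \<Psi>(2)[of "invariant_map x"] that by (intro exI[of _ "- 1 - real (idx (invariant_map x))"]) (simp add: y_def)
  qed
  then show thesis by (rule that)
qed

end

context finite_rotation_group
begin

lemma fundamental_disc_exists: "\<exists>L. fundamental_disc_map \<Gamma> L"
proof -
  obtain b where b: "b \<in> sphere 0 1 - singular_points"
    \<comment> \<open>A point with trivial stabiliser exists because the sphere is infinite and the
      singular points are finite in number.\<close>
    using infinite_sphere3 finite_singular_points by (metis finite_Diff2 finite.emptyI equals0I)
  obtain A :: "real^3^3" where A: "rotation_matrix A" "A *v axis 3 1 = b"
    using rotation_matrix_exists_basis[of b 3] b by auto
  have R: "rotation_matrix (transpose A)" "transpose A *v b = axis 3 1"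
    using A by (auto simp: rotation_matrix_def orthogonal_matrix_def det_transpose matrix_vector_mul_assoc)
  interpret rotation_group_regular_point \<Gamma> b "transpose A"
    by unfold_locales (use b R in auto)
  obtain \<Psi> where "orbit_map \<Gamma> b (\<Psi> \<circ> invariant_map)" by (rule invariant_map_straightened)
  then show ?thesis by (rule orbit_map.fundamental_disc_lift)
qed

end

section \<open>The equivariant skeleton\<close>

theorem theorem3p2:
  fixes \<Gamma> :: "(real^3^3) set"
  assumes "subgroup \<Gamma> special_orthogonal_group" and "finite \<Gamma>"
  defines "G \<equiv> special_orthogonal_group\<lparr>carrier := \<Gamma>\<rparr>"
  shows "\<exists>\<A> :: (real^3) set.
      equivariant_one_skeleton G (top_of_set (sphere 0 1)) (rot_action (sphere 0 1)) \<A> \<and>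
      (\<exists>\<phi>. split_gamma_space G (top_of_set \<A>) (rot_action \<A>)
             (orbit_space G (top_of_set \<A>) (rot_action \<A>))
             (orbit G (rot_action \<A>)) \<phi>)"
proof -
  interpret finite_rotation_group \<Gamma> by (rule finite_rotation_groupI[OF assms(1,2)])
  obtain L where "fundamental_disc_map \<Gamma> L" using fundamental_disc_exists by blast
  then interpret fundamental_disc_map \<Gamma> L .
  \<comment> \<open>The upper semicircle already meets every orbit of the skeleton, since conjugate
    boundary points have the same orbit; the lower one would repeat these orbits.\<close>
  let ?T = "(\<lambda>t. L (upper_arc t)) ` {0..1}"
  have "equivariant_one_skeleton G (top_of_set (sphere 0 1)) (rot_action (sphere 0 1)) (skeleton cells 1)"
    unfolding equivariant_one_skeleton_def G_def
    using equivariant_cw_decomposition_cells[OF assms(1)] by blast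
  moreover have "\<exists>\<phi>. split_gamma_space G (top_of_set (skeleton cells 1)) (rot_action (skeleton cells 1))
             (orbit_space G (top_of_set (skeleton cells 1)) (rot_action (skeleton cells 1)))
             (orbit G (rot_action (skeleton cells 1))) \<phi>"
    unfolding G_def
  proof (rule split_gamma_space_transversal[OF assms(1)])
    show "compact ?T"
      by (intro compact_continuous_image continuous_on_compose2[OF L_cont] continuous_intros) auto
    show "x = y" if xy: "x \<in> ?T" "y \<in> ?T" "y \<in> orb x" for x y
    proof -
      obtain s t where st: "s \<in> {0..1}" "t \<in> {0..1}" "x = L (upper_arc s)" "y = L (upper_arc t)"
        using xy(1,2) by blast
      obtain g where g: "g \<in> \<Gamma>" "y = g *v x" using xy(3) by (auto simp: orb_def)
      have "upper_arc s = upper_arc t"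
        using half_disc_inj[OF _ _ g(1) one, of "upper_arc s" "upper_arc t"] st g by (auto simp: half_disc_def)
      then show ?thesis using st by simp
    qed
    show "skeleton cells 1 = (\<Union>g\<in>\<Gamma>. (*v) g ` ?T)"
      unfolding skeleton_cells by blast
  qed
  ultimately show ?thesis by blast
qed

end
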